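(* Let $d\ge1$, $n\ge0$, $N_c\ge1$ and $N_q$ be integers with $N_q\ge n+2(N_c-1)$, let $a>0$ be fixed, and let $(w_{\mathbf i})_{\mathbf i\in\Omega}$, $\Omega\subset\mathbb Z^d$ finite, be invariant weights satisfying the Hermite norm preservation conditions of order $N_q$ with scaling $a$ (see context). Let $f:\mathbb R^d\to\mathbb R$ be a smooth function whose Taylor series about any point converges to $f$ everywhere, let $\mathbf x\in\mathbb R^d$, and let $\mathbf s\in\mathbb Z^d_{\ge0}$ with $|\mathbf s|=n$. Define $$D_h f(\mathbf x)=\left(\frac ah\right)^n\sum_{\mathbf i\in\Omega}w_{\mathbf i}\left(\sum_{j=0}^{N_c-1}\frac{(-1)^j}{2^j j!}\,H_{\mathbf s,j}(a\mathbf i)\right)f(\mathbf x+h\mathbf i).$$ Then, as $h\to0^+$, $$D_hf(\mathbf x)=\partial^{\mathbf s}f(\mathbf x)+O(h^{2N_c}).$$ More precisely, $$D_hf(\mathbf x)=\partial^{\mathbf s}f(\mathbf x)+\sum_{k=N_c}^{N_q-n-N_c+1}\left(\sum_{l=0}^{N_c-1}\frac{(-1)^l}{2^l l!}\frac{1}{2^{k-l}(k-l)!}\right)\left(\frac ha\right)^{2k}\Delta^k\partial^{\mathbf s}f(\mathbf x)+O\!\left(h^{2(N_q-n-N_c+2)}\right),$$ where the sum over $k$ is empty if $N_q<2N_c+n-1$.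
   Context: Probabilist's Hermite polynomials: $H_k(x)=(-1)^k e^{x^2/2}\frac{d^k}{dx^k}e^{-x^2/2}$. For a multi-index $\mathbf s=(s_0,\dots,s_{d-1})\in\mathbb Z_{\ge0}^d$ put $|\mathbf s|=\sum_k s_k$, $H_{\mathbf s}(\mathbf x)=\prod_{k=0}^{d-1}H_{s_k}(\mathbf x_k)$, and $\partial^{\mathbf s}=\prod_k\partial^{s_k}/\partial\mathbf x_k^{s_k}$. $\Delta=\sum_k\partial^2/\partial\mathbf x_k^2$ is the Laplacian and $\Delta^j$ its $j$-th power. The Laplacian Hermite polynomials are $$H_{\mathbf s,j}(\mathbf x)=(-1)^{|\mathbf s|}e^{|\mathbf x|^2/2}\,\Delta^j\partial^{\mathbf s}e^{-|\mathbf x|^2/2}.$$ Let $\omega(x)=\frac1{\sqrt{2\pi}}e^{-x^2/2}$. Weights: $\Omega\subset\mathbb Z^d$ is a finite set and $w_{\mathbf i}\in\mathbb R$ for $\mathbf i\in\Omega$. "Invariant" means that $\Omega$ and $w$ are unchanged under permuting the coordinates of $\mathbf i$ and under changing the sign of any coordinate of $\mathbf i$. The "Hermite norm preservation conditions of order $N_q$ with scaling $a$" are: for every multi-index $\mathbf s$ with $|\mathbf s|\le N_q$, $$\sum_{\mathbf i\in\Omega}w_{\mathbf i}\,H_{\mathbf s}(a\mathbf i)^2=\int_{\mathbb R^d}\prod_{k=0}^{d-1}H_{s_k}(\mathbf x_k)^2\,\omega(\mathbf x_k)\,d\mathbf x .$$ *)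

theory Defs
  imports "HOL-Probability.Probability" "HOL-Library.Landau_Symbols"
begin

text \<open>
  Points of $R^d$ are vectors of type \<^typ>\<open>real ^ 'd\<close>, lattice points and multi-indices are
  vectors of type \<^typ>\<open>int ^ 'd\<close> and \<^typ>\<open>nat ^ 'd\<close>; thus $d$ is the cardinality of the
  arbitrary finite (nonempty) type \<^typ>\<open>'d\<close>.
\<close>

definition partial :: "'d::finite \<Rightarrow> (real ^ 'd \<Rightarrow> real) \<Rightarrow> real ^ 'd \<Rightarrow> real" where
  "partial k f x = deriv (\<lambda>t. f (x + t *\<^sub>R axis k 1)) 0"

definition has_partial_at :: "'d::finite \<Rightarrow> (real ^ 'd \<Rightarrow> real) \<Rightarrow> real ^ 'd \<Rightarrow> bool" where
  "has_partial_at k f x \<longleftrightarrow> (\<lambda>t. f (x + t *\<^sub>R axis k 1)) differentiable (at 0)"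

definition smooth :: "(real ^ 'd::finite \<Rightarrow> real) \<Rightarrow> bool" where
  "smooth f \<longleftrightarrow> (\<forall>ks. continuous_on UNIV (foldr partial ks f) \<and>
                     (\<forall>k x. has_partial_at k (foldr partial ks f) x))"

text \<open>
  A fixed enumeration of the coordinates, giving the order of composition in
  \<open>mixed_partial\<close>. The operator is only applied to smooth functions, whose partial
  derivatives commute, so the choice does not matter.
\<close>

definition coords :: "'d::finite list" where
  "coords = (SOME ks. distinct ks \<and> set ks = UNIV)"

lemma coords: "distinct (coords :: 'd::finite list)" "set (coords :: 'd list) = UNIV"
proof -
  have "\<exists>ks :: 'd list. distinct ks \<and> set ks = UNIV"
    using finite_distinct_list[OF finite_class.finite_UNIV] by blast
  from someI_ex[OF this] show "distinct (coords :: 'd list)" "set (coords :: 'd list) = UNIV"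
    by (simp_all add: coords_def)
qed

definition mixed_partial :: "nat ^ 'd::finite \<Rightarrow> (real ^ 'd \<Rightarrow> real) \<Rightarrow> real ^ 'd \<Rightarrow> real" where
  "mixed_partial s f = foldr (\<lambda>k. partial k ^^ (s $ k)) coords f"

definition laplacian :: "(real ^ 'd::finite \<Rightarrow> real) \<Rightarrow> real ^ 'd \<Rightarrow> real" where
  "laplacian f x = (\<Sum>k\<in>UNIV. partial k (partial k f) x)"

definition msize :: "nat ^ 'd::finite \<Rightarrow> nat" where
  "msize s = (\<Sum>k\<in>UNIV. s $ k)"

definition taylor_converges :: "(real ^ 'd::finite \<Rightarrow> real) \<Rightarrow> bool" where
  "taylor_converges f \<longleftrightarrow> (\<forall>y x.
     ((\<lambda>\<alpha> :: nat ^ 'd. mixed_partial \<alpha> f y / (\<Prod>k\<in>UNIV. fact (\<alpha> $ k))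
                        * (\<Prod>k\<in>UNIV. (x $ k - y $ k) ^ (\<alpha> $ k))) has_sum f x) UNIV)"

definition hermite :: "nat \<Rightarrow> real \<Rightarrow> real" where
  "hermite k x = (- 1) ^ k * exp (x\<^sup>2 / 2) * (deriv ^^ k) (\<lambda>y. exp (- y\<^sup>2 / 2)) x"

definition mhermite :: "nat ^ 'd::finite \<Rightarrow> real ^ 'd \<Rightarrow> real" where
  "mhermite s x = (\<Prod>k\<in>UNIV. hermite (s $ k) (x $ k))"

definition laplacian_hermite :: "nat ^ 'd::finite \<Rightarrow> nat \<Rightarrow> real ^ 'd \<Rightarrow> real" where
  "laplacian_hermite s j x =
     (- 1) ^ msize s * exp ((norm x)\<^sup>2 / 2)
       * (laplacian ^^ j) (mixed_partial s (\<lambda>y. exp (- (norm y)\<^sup>2 / 2))) x"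

definition rvec :: "int ^ 'd::finite \<Rightarrow> real ^ 'd" where
  "rvec i = (\<chi> k. real_of_int (i $ k))"

definition permute_coords :: "('d \<Rightarrow> 'd) \<Rightarrow> int ^ 'd::finite \<Rightarrow> int ^ 'd" where
  "permute_coords \<pi> i = (\<chi> k. i $ \<pi> k)"

definition flip_sign :: "'d \<Rightarrow> int ^ 'd::finite \<Rightarrow> int ^ 'd" where
  "flip_sign m i = (\<chi> k. if k = m then - (i $ k) else i $ k)"

definition invariant_weights :: "(int ^ 'd::finite) set \<Rightarrow> (int ^ 'd \<Rightarrow> real) \<Rightarrow> bool" where
  "invariant_weights \<Omega> w \<longleftrightarrow>
     (\<forall>\<pi>. bij \<pi> \<longrightarrow> permute_coords \<pi> ` \<Omega> = \<Omega> \<and> (\<forall>i\<in>\<Omega>. w (permute_coords \<pi> i) = w i)) \<and>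
     (\<forall>m. flip_sign m ` \<Omega> = \<Omega> \<and> (\<forall>i\<in>\<Omega>. w (flip_sign m i) = w i))"

definition hermite_norm_preserving ::
    "nat \<Rightarrow> real \<Rightarrow> (int ^ 'd::finite) set \<Rightarrow> (int ^ 'd \<Rightarrow> real) \<Rightarrow> bool" where
  "hermite_norm_preserving N\<^sub>q a \<Omega> w \<longleftrightarrow>
     (\<forall>s. msize s \<le> N\<^sub>q \<longrightarrow>
        (\<Sum>i\<in>\<Omega>. w i * (mhermite s (a *\<^sub>R rvec i))\<^sup>2)
          = (LINT x|(lborel :: (real ^ 'd) measure).
               (\<Prod>k\<in>UNIV. (hermite (s $ k) (x $ k))\<^sup>2 * std_normal_density (x $ k))))"

definition discrete_deriv ::
    "real \<Rightarrow> (int ^ 'd::finite) set \<Rightarrow> (int ^ 'd \<Rightarrow> real) \<Rightarrow> nat \<Rightarrow> nat ^ 'd \<Rightarrow>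
     (real ^ 'd \<Rightarrow> real) \<Rightarrow> real ^ 'd \<Rightarrow> real \<Rightarrow> real" where
  "discrete_deriv a \<Omega> w N\<^sub>c s f x h =
     (a / h) ^ msize s *
       (\<Sum>i\<in>\<Omega>. w i * (\<Sum>j = 0..N\<^sub>c - 1. (- 1) ^ j / (2 ^ j * fact j)
                            * laplacian_hermite s j (a *\<^sub>R rvec i))
               * f (x + h *\<^sub>R rvec i))"

end

theory Submission
  imports Defs
begin

text \<open>
  Invariance and norm preservation make the weights a cubature rule for the Gaussian measure which
  is exact on polynomials of degree at most $2N_q+1$: monomials with an odd exponent vanish on both
  sides, and $H_{\mathbf t}^2$ has leading monomial $\mathbf x^{2\mathbf t}$, so induction on the
  degree yields the even ones. Inserting the Taylor series of $f$ at $\mathbf x$ into $D_hf$, all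
  terms of degree at most $2N_q+1-n-2(N_c-1)$ are therefore Gaussian integrals of a Hermite
  polynomial against a monomial. By integration by parts only the exponents
  $\mathbf s+2\mathbf k$ contribute, and the multinomial expansion of $\Delta^k$ together with a
  Vandermonde convolution assembles them to the stated multiples of $\Delta^k\partial^{\mathbf s}f$.
  For $0<k<N_c$ the multiple is a full alternating sum of binomial coefficients, hence zero.
\<close>

section \<open>Hermite polynomials and Gaussian moments\<close>

text \<open>For a standard Gaussian vector Z, integration by parts formally gives
  E[H_{s,j}(Z) f(x + tZ)] = t^(|s|+2j) \<Delta>^j \<partial>^s exp(t^2 \<Delta>/2) f(x). With t =
  h/a, the sum over j therefore composes the smoothing operator exp(t^2 \<Delta>/2) with its inverse
  exp(-t^2 \<Delta>/2) truncated after \<open>N\<^sub>c\<close> terms. The product agrees with the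
  identity below order t^(2 \<open>N\<^sub>c\<close>), and its higher coefficients are those of the
  theorem. The proof verifies this coefficient by coefficient on Taylor polynomials, where all sums
  are finite.

  The expansion stops at K = \<open>N\<^sub>q\<close> + 1 - n - \<open>N\<^sub>c\<close> because the
  Taylor degree n + 2K + 1 is then the last one within reach of exactness. The first omitted degree
  n + 2K + 2 loses n orders to the prefactor (a/h)^n, which leaves h^(2(K + 1)).

  Smoothness is phrased through continuous iterated partial derivatives along the axes, so their
  commutation has to be proved before \<Delta>^j can be expanded.\<close>

primrec hermite_poly :: "nat \<Rightarrow> real poly" where
  "hermite_poly 0 = 1"
| "hermite_poly (Suc k) = pCons 0 (hermite_poly k) - pderiv (hermite_poly k)"

lemma has_field_derivative_poly_gauss:
  "((\<lambda>y. (- 1) ^ k * poly (hermite_poly k) y * exp (- y\<^sup>2 / 2)) has_field_derivative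
     (- 1) ^ Suc k * poly (hermite_poly (Suc k)) y * exp (- y\<^sup>2 / 2)) (at (y :: real))"
  by (auto intro!: derivative_eq_intros simp: algebra_simps)

lemma higher_deriv_gauss:
  "(deriv ^^ k) (\<lambda>y. exp (- y\<^sup>2 / 2)) = (\<lambda>y :: real. (- 1) ^ k * poly (hermite_poly k) y * exp (- y\<^sup>2 / 2))"
proof (induction k)
  case (Suc k)
  show ?case
  proof
    fix y :: real
    have "deriv (\<lambda>y. (- 1) ^ k * poly (hermite_poly k) y * exp (- y\<^sup>2 / 2)) y
        = (- 1) ^ Suc k * poly (hermite_poly (Suc k)) y * exp (- y\<^sup>2 / 2)"
      by (rule DERIV_imp_deriv[OF has_field_derivative_poly_gauss])
    then show "(deriv ^^ Suc k) (\<lambda>y. exp (- y\<^sup>2 / 2)) y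
        = (- 1) ^ Suc k * poly (hermite_poly (Suc k)) y * exp (- y\<^sup>2 / 2)"
      by (simp only: funpow.simps o_def Suc.IH)
  qed
qed simp

lemma has_field_derivative_higher_deriv_gauss:
  "((deriv ^^ k) (\<lambda>y. exp (- y\<^sup>2 / 2)) has_field_derivative
     (deriv ^^ Suc k) (\<lambda>y. exp (- y\<^sup>2 / 2)) y) (at (y :: real))"
  unfolding higher_deriv_gauss by (rule has_field_derivative_poly_gauss)

lemma hermite_eq_poly: "hermite k = poly (hermite_poly k)"
proof
  fix x :: real
  have "(- 1 :: real) ^ k * (- 1) ^ k = 1" by (simp flip: power_mult_distrib)
  moreover have "exp (x\<^sup>2 / 2) * exp (- x\<^sup>2 / 2) = 1" by (simp flip: exp_add)
  ultimately show "hermite k x = poly (hermite_poly k) x"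
    unfolding hermite_def higher_deriv_gauss by (simp add: algebra_simps exp_minus)
qed

lemma coeff_hermite_poly_eq_0: "k < i \<Longrightarrow> coeff (hermite_poly k) i = 0"
  by (induction k arbitrary: i) (auto simp: coeff_pCons coeff_pderiv split: nat.split)

lemma coeff_hermite_poly_self: "coeff (hermite_poly k) k = 1"
  by (induction k) (auto simp: coeff_pderiv coeff_hermite_poly_eq_0)

lemma degree_hermite_poly: "degree (hermite_poly k) = k"
  using coeff_hermite_poly_eq_0[of k] coeff_hermite_poly_self[of k]
  by (metis degree_le le_degree order_antisym zero_neq_one)

text \<open>For even \<open>m\<close> this is the double factorial (m - 1)!!, written with ordinary
  factorials so that it later combines with binomial coefficients.\<close>

definition gauss_moment :: "nat \<Rightarrow> real" where
  "gauss_moment m = (if even m then fact m / (2 ^ (m div 2) * fact (m div 2)) else 0)"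

lemma gauss_moment_double: "gauss_moment (2 * l) = fact (2 * l) / (2 ^ l * fact l)"
  by (simp add: gauss_moment_def)

lemma gauss_moment_odd: "odd m \<Longrightarrow> gauss_moment m = 0"
  by (simp add: gauss_moment_def)

text \<open>This recursion is integration by parts on a single monomial. For odd \<open>m\<close>
  both sides are zero.\<close>

lemma gauss_moment_Suc_Suc: "gauss_moment (Suc (Suc m)) = real (Suc m) * gauss_moment m"
proof (cases "even m")
  case True
  then obtain b where m: "m = 2 * b" by blast
  have 1: "fact (2 * Suc b) = 2 * real (Suc b) * (real (Suc m) * fact (2 * b))"
    by (simp add: m algebra_simps)
  have 2: "2 ^ Suc b * fact (Suc b) = 2 * real (Suc b) * (2 ^ b * fact b)"
    by simp
  have "gauss_moment (Suc (Suc m)) = fact (2 * Suc b) / (2 ^ Suc b * fact (Suc b))"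
    by (simp only: m gauss_moment_double[symmetric]) simp
  also have "\<dots> = real (Suc m) * fact (2 * b) / (2 ^ b * fact b)"
    unfolding 1 2 by (rule mult_divide_mult_cancel_left) simp
  finally show ?thesis by (simp add: m gauss_moment_double)
qed (simp add: gauss_moment_odd)

lemma has_bochner_integral_gauss_moment:
  "has_bochner_integral lborel (\<lambda>y. y ^ m * std_normal_density y) (gauss_moment m)"
proof -
  have "has_bochner_integral lborel (\<lambda>y. std_normal_density y * y ^ m) (gauss_moment m)"
  proof (cases "even m")
    case True
    then obtain b where m: "m = 2 * b" by blast
    show ?thesis unfolding m gauss_moment_double by (rule std_normal_moment_even)
  next
    case False
    then obtain b where m: "m = 2 * b + 1" by (blast elim: oddE)
    show ?thesis unfolding m using std_normal_moment_odd by (simp add: gauss_moment_odd)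
  qed
  then show ?thesis by (simp only: mult.commute)
qed

text \<open>An arbitrary bound \<open>d\<close> is allowed because degrees of products and shifts
  are only controlled from above; the zero polynomial makes them drop.\<close>

lemma poly_eq_sum_of_degree_le:
  "degree p \<le> d \<Longrightarrow> poly p y = (\<Sum>i\<le>d. coeff p i * y ^ i)"
  for p :: "'a::comm_semiring_1 poly"
  by (subst poly_as_sum_of_monoms'[symmetric]) (auto simp: poly_sum poly_monom)

text \<open>Taking polynomials as arguments makes integrability automatic, so the linearity rules
  carry no side conditions.\<close>

definition gauss_expect :: "real poly \<Rightarrow> real" where
  "gauss_expect p = (LINT y|lborel. poly p y * std_normal_density y)"

lemma has_bochner_integral_gauss_expect_sum:
  assumes "degree p \<le> d"
  shows "has_bochner_integral lborel (\<lambda>y. poly p y * std_normal_density y)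
           (\<Sum>i\<le>d. coeff p i * gauss_moment i)"
proof -
  have eq: "poly p y * std_normal_density y
          = (\<Sum>i\<le>d. coeff p i * (y ^ i * std_normal_density y))" for y
    by (subst poly_eq_sum_of_degree_le[OF assms]) (simp add: sum_distrib_right mult.assoc)
  show ?thesis unfolding eq
    by (intro has_bochner_integral_sum has_bochner_integral_mult_right
          has_bochner_integral_gauss_moment)
qed

lemma gauss_expect_eq_sum:
  "degree p \<le> d \<Longrightarrow> gauss_expect p = (\<Sum>i\<le>d. coeff p i * gauss_moment i)"
  unfolding gauss_expect_def
  by (rule has_bochner_integral_integral_eq, rule has_bochner_integral_gauss_expect_sum)

lemma integrable_poly_gauss: "integrable lborel (\<lambda>y. poly p y * std_normal_density y)"
  using has_bochner_integral_gauss_expect_sum[OF order_refl, of p]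
  by (auto simp: has_bochner_integral_iff)

lemma gauss_expect_diff: "gauss_expect (p - q) = gauss_expect p - gauss_expect q"
  by (simp add: gauss_expect_def integrable_poly_gauss algebra_simps)

lemma gauss_expect_smult: "gauss_expect (smult c p) = c * gauss_expect p"
  by (simp add: gauss_expect_def algebra_simps)

lemma gauss_expect_monom: "gauss_expect (monom 1 m) = gauss_moment m"
  using has_bochner_integral_gauss_moment[of m]
  by (auto simp: gauss_expect_def poly_monom has_bochner_integral_iff)

text \<open>Gaussian integration by parts, which makes each Hermite factor act as a derivative.\<close>

lemma gauss_expect_pCons_0: "gauss_expect (pCons 0 q) = gauss_expect (pderiv q)"
proof -
  define d where "d = degree q"
  have "gauss_expect (pCons 0 q) = (\<Sum>i\<le>Suc (Suc d). coeff (pCons 0 q) i * gauss_moment i)"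
    by (rule gauss_expect_eq_sum) (simp add: d_def)
  also have "\<dots> = (\<Sum>i\<le>d. coeff q (Suc i) * gauss_moment (Suc (Suc i)))"
    by (simp only: sum.atMost_Suc_shift) (simp add: gauss_moment_odd)
  also have "\<dots> = (\<Sum>i\<le>d. coeff (pderiv q) i * gauss_moment i)"
    by (intro sum.cong) (simp_all add: gauss_moment_Suc_Suc coeff_pderiv)
  also have "\<dots> = gauss_expect (pderiv q)"
    by (rule gauss_expect_eq_sum[symmetric]) (simp add: d_def degree_pderiv)
  finally show ?thesis .
qed

text \<open>Integration by parts differentiates the whole product; the term with
  \<open>pderiv (hermite_poly p)\<close> cancels against the one in the Hermite recursion.\<close>

lemma gauss_expect_hermite_poly_Suc:
  "gauss_expect (hermite_poly (Suc p) * q) = gauss_expect (hermite_poly p * pderiv q)"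
proof -
  have "hermite_poly (Suc p) * q = pCons 0 (hermite_poly p * q) - pderiv (hermite_poly p) * q"
    by (simp add: algebra_simps)
  then show ?thesis
    by (simp only: gauss_expect_diff gauss_expect_pCons_0)
       (simp add: pderiv_mult gauss_expect_diff[symmetric])
qed

text \<open>All p derivatives are moved onto the monomial, which leaves the falling factorial of m,
  or zero once p exceeds m.\<close>

lemma gauss_expect_hermite_poly_monom:
  "gauss_expect (hermite_poly p * monom 1 m)
     = (if p \<le> m then fact m / fact (m - p) * gauss_moment (m - p) else 0)"
proof (induction p arbitrary: m)
  case 0
  then show ?case by (simp add: gauss_expect_monom)
next
  case (Suc p)
  show ?case
  proof (cases m)
    case 0
    then show ?thesis
      by (simp only: gauss_expect_hermite_poly_Suc) (simp add: gauss_expect_def)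
  next
    case (Suc m')
    have "pderiv (monom 1 m) = smult (real m) (monom 1 m')"
      by (simp add: pderiv_monom smult_monom Suc)
    then show ?thesis
      by (simp only: gauss_expect_hermite_poly_Suc mult_smult_right gauss_expect_smult Suc.IH)
         (simp add: Suc)
  qed
qed

section \<open>Multi-indices\<close>

lemma finite_vec_le: "finite {\<beta> :: nat ^ 'd::finite. \<forall>k. \<beta> $ k \<le> \<kappa> $ k}"
proof -
  have "{\<beta>. \<forall>k. \<beta> $ k \<le> \<kappa> $ k} \<subseteq> vec_lambda ` (\<Pi>\<^sub>E k\<in>UNIV. {..\<kappa> $ k})"
  proof
    fix \<beta> assume "\<beta> \<in> {\<beta>. \<forall>k. \<beta> $ k \<le> \<kappa> $ k}"
    then have "vec_nth \<beta> \<in> (\<Pi>\<^sub>E k\<in>UNIV. {..\<kappa> $ k})" by (simp add: PiE_UNIV_domain)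
    then have "vec_lambda (vec_nth \<beta>) \<in> vec_lambda ` (\<Pi>\<^sub>E k\<in>UNIV. {..\<kappa> $ k})" by (rule imageI)
    then show "\<beta> \<in> vec_lambda ` (\<Pi>\<^sub>E k\<in>UNIV. {..\<kappa> $ k})" by simp
  qed
  then show ?thesis by (rule finite_subset) (simp add: finite_PiE)
qed

lemma prod_sum_vec:
  fixes g :: "'d::finite \<Rightarrow> nat \<Rightarrow> 'a::comm_semiring_1"
  shows "(\<Prod>k\<in>UNIV. \<Sum>b\<le>\<kappa> $ k. g k b)
           = (\<Sum>\<beta> | \<forall>k. \<beta> $ k \<le> \<kappa> $ k. \<Prod>k\<in>UNIV. g k (\<beta> $ k))"
proof -
  have "(\<Prod>k\<in>UNIV. \<Sum>b\<le>\<kappa> $ k. g k b)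
      = (\<Sum>h\<in>(\<Pi>\<^sub>E k\<in>UNIV. {..\<kappa> $ k}). \<Prod>k\<in>UNIV. g k (h k))"
    by (rule prod_sum_PiE) auto
  also have "\<dots> = (\<Sum>\<beta> | \<forall>k. \<beta> $ k \<le> \<kappa> $ k. \<Prod>k\<in>UNIV. g k (\<beta> $ k))"
    by (rule sum.reindex_bij_witness[of _ vec_nth vec_lambda]) (auto simp: PiE_UNIV_domain)
  finally show ?thesis .
qed

lemma nth_le_msize: "\<beta> $ k \<le> msize \<beta>"
  unfolding msize_def by (rule member_le_sum) auto

lemma msize_add: "msize (\<alpha> + \<beta>) = msize \<alpha> + msize \<beta>"
  by (simp add: msize_def sum.distrib)

lemma msize_axis: "msize (axis k 1) = 1"
  by (simp add: msize_def axis_def)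

lemma msize_eq_0_iff: "msize \<beta> = 0 \<longleftrightarrow> \<beta> = 0"
  by (auto simp: msize_def vec_eq_iff)

lemma finite_msize_le: "finite {\<beta> :: nat ^ 'd::finite. msize \<beta> \<le> j}"
  by (rule finite_subset[OF _ finite_vec_le[of "\<chi> k. j"]])
     (auto intro: order_trans[OF nth_le_msize])

lemma finite_msize_eq: "finite {\<beta> :: nat ^ 'd::finite. msize \<beta> = j}"
  by (rule finite_subset[OF _ finite_msize_le[of j]]) auto

section \<open>Multivariate Vandermonde identity and multinomial recursion\<close>

lemma prod_monom: "finite A \<Longrightarrow> (\<Prod>k\<in>A. monom (c k) (e k)) = monom (\<Prod>k\<in>A. c k) (\<Sum>k\<in>A. e k)"
  by (induction A rule: finite_induct) (auto simp: mult_monom)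

lemma binomial_poly: "[:1, 1:] ^ n = (\<Sum>b\<le>n. monom (real (n choose b)) b)"
proof -
  have "[:1, 1:] ^ n = (monom 1 1 + 1 :: real poly) ^ n"
    by (simp add: monom_altdef one_pCons)
  also have "\<dots> = (\<Sum>b\<le>n. monom (real (n choose b)) b)"
    unfolding binomial_ring
    by (simp add: monom_power of_nat_monom mult_monom)
  finally show ?thesis .
qed

text \<open>Compare coefficients of X^l in (1 + X)^|\<kappa>| and in the product of the (1 +
  X)^(\<kappa>_k). The sum may run over all \<beta> of size l, since outside the box \<beta> \<le>
  \<kappa> some binomial factor vanishes.\<close>

lemma sum_prod_binomial:
  fixes \<kappa> :: "nat ^ 'd::finite"
  shows "(\<Sum>\<beta> | msize \<beta> = l. \<Prod>k\<in>UNIV. real (\<kappa> $ k choose \<beta> $ k)) = real (msize \<kappa> choose l)"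
proof -
  have "[:1, 1:] ^ msize \<kappa> = (\<Prod>k\<in>UNIV. [:1, 1 :: real:] ^ (\<kappa> $ k))"
    by (simp add: msize_def power_sum)
  also have "\<dots> = (\<Sum>\<beta> | \<forall>k. \<beta> $ k \<le> \<kappa> $ k.
                 monom (\<Prod>k\<in>UNIV. real (\<kappa> $ k choose \<beta> $ k)) (msize \<beta>))"
    unfolding binomial_poly prod_sum_vec by (simp add: prod_monom msize_def)
  finally have "coeff ([:1, 1:] ^ msize \<kappa>) l = (\<Sum>\<beta> | \<forall>k. \<beta> $ k \<le> \<kappa> $ k.
                 if msize \<beta> = l then (\<Prod>k\<in>UNIV. real (\<kappa> $ k choose \<beta> $ k)) else 0)"
    by (simp add: coeff_sum)
  also have "\<dots> = (\<Sum>\<beta> | msize \<beta> = l \<and> (\<forall>k. \<beta> $ k \<le> \<kappa> $ k).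
                     \<Prod>k\<in>UNIV. real (\<kappa> $ k choose \<beta> $ k))"
    by (subst sum.inter_filter[symmetric]) (auto simp: finite_vec_le conj_commute)
  also have "\<dots> = (\<Sum>\<beta> | msize \<beta> = l. \<Prod>k\<in>UNIV. real (\<kappa> $ k choose \<beta> $ k))"
    by (rule sum.mono_neutral_left) (auto simp: finite_msize_eq not_le)
  also have "coeff ([:1, 1:] ^ msize \<kappa>) l = real (msize \<kappa> choose l)"
    by (auto simp: binomial_poly coeff_sum not_le)
  finally show ?thesis by simp
qed

definition mfact :: "nat ^ 'd::finite \<Rightarrow> real" where
  "mfact \<beta> = (\<Prod>k\<in>UNIV. fact (\<beta> $ k))"

lemma mfact_nonzero: "mfact \<beta> \<noteq> 0"
  by (simp add: mfact_def)

lemma mfact_add_axis: "mfact (\<beta> + axis k 1) = real (Suc (\<beta> $ k)) * mfact \<beta>"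
proof -
  have "mfact (\<beta> + axis k 1) = fact (Suc (\<beta> $ k)) * (\<Prod>m\<in>UNIV - {k}. fact (\<beta> $ m))"
    unfolding mfact_def
    by (subst prod.remove[of _ k]) (auto simp: axis_def intro!: prod.cong)
  also have "\<dots> = real (Suc (\<beta> $ k)) * mfact \<beta>"
    unfolding mfact_def by (subst (2) prod.remove[of _ k]) (auto simp: mult.assoc)
  finally show ?thesis .
qed

text \<open>Inductive step of the multinomial theorem: write the factor j + 1 as the sum of the
  entries of \<beta>, then lower \<beta> by one in the chosen coordinate. \<open>F\<close> stays
  arbitrary so that derivatives of order s + 2\<beta> can be inserted.\<close>

lemma sum_multinomial_Suc:
  fixes F :: "nat ^ 'd::finite \<Rightarrow> real"
  shows "(\<Sum>\<beta> | msize \<beta> = Suc j. fact (Suc j) / mfact \<beta> * F \<beta>)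
       = (\<Sum>k\<in>UNIV. \<Sum>\<beta> | msize \<beta> = j. fact j / mfact \<beta> * F (\<beta> + axis k 1))"
proof -
  have shift: "(\<Sum>\<beta> | msize \<beta> = Suc j. real (\<beta> $ k) * (fact j / mfact \<beta> * F \<beta>))
             = (\<Sum>\<beta> | msize \<beta> = j. fact j / mfact \<beta> * F (\<beta> + axis k 1))" for k
  proof -
    \<comment> \<open>The factor \<beta>_k removes the indices with \<beta>_k = 0, for which the
      truncated subtraction \<open>\<beta> - axis k 1\<close> could not be undone.\<close>
    have "(\<Sum>\<beta> | msize \<beta> = Suc j. real (\<beta> $ k) * (fact j / mfact \<beta> * F \<beta>))
        = (\<Sum>\<beta> | msize \<beta> = Suc j \<and> \<beta> $ k > 0. real (\<beta> $ k) * (fact j / mfact \<beta> * F \<beta>))"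
      by (rule sum.mono_neutral_right) (auto simp: finite_msize_eq)
    also have "\<dots> = (\<Sum>\<beta> | msize \<beta> = j. fact j / mfact \<beta> * F (\<beta> + axis k 1))"
    proof (rule sum.reindex_bij_witness[of _ "\<lambda>\<beta>. \<beta> + axis k 1" "\<lambda>\<beta>. \<beta> - axis k 1"])
      fix \<beta> :: "nat ^ 'd"
      assume "\<beta> \<in> {\<beta>. msize \<beta> = Suc j \<and> \<beta> $ k > 0}"
      then have *: "\<beta> - axis k 1 + axis k 1 = \<beta>" "msize \<beta> = Suc j"
        by (simp_all add: vec_eq_iff axis_def del: One_nat_def)
      then show "\<beta> - axis k 1 + axis k 1 = \<beta>" by simp
      show "\<beta> - axis k 1 \<in> {\<beta>. msize \<beta> = j}"
        using * msize_add[of "\<beta> - axis k 1" "axis k 1"] by (simp add: msize_axis del: One_nat_def)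
      have "real (\<beta> $ k) / mfact \<beta> = 1 / mfact (\<beta> - axis k 1)"
        using mfact_add_axis[of "\<beta> - axis k 1" k] * \<open>\<beta> \<in> _\<close> mfact_nonzero[of "\<beta> - axis k 1"]
        by (simp add: axis_def)
      then have "fact j * F \<beta> * (1 / mfact (\<beta> - axis k 1)) = fact j * F \<beta> * (real (\<beta> $ k) / mfact \<beta>)"
        by simp
      then show "fact j / mfact (\<beta> - axis k 1) * F (\<beta> - axis k 1 + axis k 1)
               = real (\<beta> $ k) * (fact j / mfact \<beta> * F \<beta>)"
        unfolding * by (simp add: mult_ac)
    next
      fix \<beta> :: "nat ^ 'd"
      show "\<beta> + axis k 1 - axis k 1 = \<beta>" by (simp add: vec_eq_iff)
      assume "\<beta> \<in> {\<beta>. msize \<beta> = j}"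
      then show "\<beta> + axis k 1 \<in> {\<beta>. msize \<beta> = Suc j \<and> \<beta> $ k > 0}"
        by (simp add: msize_add msize_axis axis_nth del: One_nat_def)
    qed
    finally show ?thesis .
  qed
  have "(\<Sum>\<beta> | msize \<beta> = Suc j. fact (Suc j) / mfact \<beta> * F \<beta>)
      = (\<Sum>\<beta> | msize \<beta> = Suc j. \<Sum>k\<in>UNIV. real (\<beta> $ k) * (fact j / mfact \<beta> * F \<beta>))"
  proof (rule sum.cong)
    fix \<beta> :: "nat ^ 'd"
    assume "\<beta> \<in> {\<beta>. msize \<beta> = Suc j}"
    then have "real (Suc j) = (\<Sum>k\<in>UNIV. real (\<beta> $ k))"
      by (auto simp: msize_def simp flip: of_nat_sum)
    then show "fact (Suc j) / mfact \<beta> * F \<beta> = (\<Sum>k\<in>UNIV. real (\<beta> $ k) * (fact j / mfact \<beta> * F \<beta>))"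
      by (simp only: sum_distrib_right[symmetric] fact_Suc) simp
  qed simp
  also have "\<dots> = (\<Sum>k\<in>UNIV. \<Sum>\<beta> | msize \<beta> = Suc j. real (\<beta> $ k) * (fact j / mfact \<beta> * F \<beta>))"
    by (rule sum.swap)
  finally show ?thesis by (simp only: shift)
qed

section \<open>Partial derivatives\<close>

lemma smoothD:
  assumes "smooth f"
  shows "continuous_on UNIV f" "has_partial_at k f x"
  using assms unfolding smooth_def by (auto dest!: spec[of _ "[]"])

lemma smooth_foldr_partial: "smooth f \<Longrightarrow> smooth (foldr partial ks f)"
  unfolding smooth_def by (auto simp flip: foldr_append)

lemma smooth_partial: "smooth f \<Longrightarrow> smooth (partial k f)"
  using smooth_foldr_partial[of f "[k]"] by simp

text \<open>The definition differentiates only at parameter 0; moving the base point along the line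
  reaches every t, as the mean value theorem requires.\<close>

lemma has_field_derivative_partial:
  assumes "has_partial_at k f (x + t *\<^sub>R axis k 1)"
  shows "((\<lambda>t. f (x + t *\<^sub>R axis k 1)) has_field_derivative partial k f (x + t *\<^sub>R axis k 1)) (at t)"
proof -
  have "((\<lambda>r. f (x + t *\<^sub>R axis k 1 + r *\<^sub>R axis k 1)) has_field_derivative
           partial k f (x + t *\<^sub>R axis k 1)) (at 0)"
    using assms unfolding has_partial_at_def partial_def
    by (simp add: DERIV_deriv_iff_real_differentiable)
  then have "((\<lambda>r. f (x + (r + t) *\<^sub>R axis k 1)) has_field_derivative
           partial k f (x + t *\<^sub>R axis k 1)) (at 0)"
    by (simp add: scaleR_add_left add_ac)
  then show ?thesis
    using DERIV_shift[of "\<lambda>r. f (x + r *\<^sub>R axis k 1)" _ 0 t] by simp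
qed

text \<open>The left-hand side is symmetric in $i$ and $j$; letting $h\to 0$ shows that partial derivatives commute.\<close>

lemma second_difference_eq_partial:
  fixes f :: "real ^ 'd::finite \<Rightarrow> real"
  assumes "smooth f" "h > 0"
  shows "\<exists>\<xi> \<eta>. 0 < \<xi> \<and> \<xi> < h \<and> 0 < \<eta> \<and> \<eta> < h \<and>
           f (x + h *\<^sub>R axis i 1 + h *\<^sub>R axis j 1) - f (x + h *\<^sub>R axis i 1)
             - f (x + h *\<^sub>R axis j 1) + f x
           = h * h * partial j (partial i f) (x + \<xi> *\<^sub>R axis i 1 + \<eta> *\<^sub>R axis j 1)"
proof -
  let ?e = "\<lambda>k. axis k 1 :: real ^ 'd"
  let ?G = "\<lambda>s. f ((x + h *\<^sub>R ?e j) + s *\<^sub>R ?e i) - f (x + s *\<^sub>R ?e i)"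
  let ?G' = "\<lambda>s. partial i f ((x + h *\<^sub>R ?e j) + s *\<^sub>R ?e i) - partial i f (x + s *\<^sub>R ?e i)"
  have "(?G has_field_derivative ?G' s) (at s)" for s
    by (intro DERIV_diff has_field_derivative_partial smoothD assms)
  with MVT2[OF \<open>h > 0\<close>, of ?G ?G'] obtain \<xi> where \<xi>: "0 < \<xi>" "\<xi> < h"
    "?G h - ?G 0 = (h - 0) * ?G' \<xi>" by blast
  let ?K = "\<lambda>t. partial i f ((x + \<xi> *\<^sub>R ?e i) + t *\<^sub>R ?e j)"
  let ?K' = "\<lambda>t. partial j (partial i f) ((x + \<xi> *\<^sub>R ?e i) + t *\<^sub>R ?e j)"
  have "(?K has_field_derivative ?K' t) (at t)" for t
    by (intro has_field_derivative_partial smoothD smooth_partial assms)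
  with MVT2[OF \<open>h > 0\<close>, of ?K ?K'] obtain \<eta> where \<eta>: "0 < \<eta>" "\<eta> < h"
    "?K h - ?K 0 = (h - 0) * ?K' \<eta>" by blast
  have "?G h - ?G 0 = h * h * ?K' \<eta>"
    using \<xi>(3) \<eta>(3) by (simp add: add_ac)
  then have "f (x + h *\<^sub>R ?e i + h *\<^sub>R ?e j) - f (x + h *\<^sub>R ?e i) - f (x + h *\<^sub>R ?e j) + f x
           = h * h * ?K' \<eta>"
    by (simp add: add_ac)
  with \<xi> \<eta> show ?thesis by blast
qed

lemma partial_commute:
  fixes f :: "real ^ 'd::finite \<Rightarrow> real"
  assumes "smooth f"
  shows "partial i (partial j f) = partial j (partial i f)"
proof
  fix x
  let ?P = "partial i (partial j f)" and ?Q = "partial j (partial i f)"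
  have "\<bar>?P x - ?Q x\<bar> \<le> \<epsilon>" if "\<epsilon> > 0" for \<epsilon>
  proof -
    have cont: "isCont ?P x" "isCont ?Q x"
      using smoothD(1)[OF smooth_partial[OF smooth_partial[OF assms]]]
      by (auto simp: continuous_on_eq_continuous_at)
    from cont(1) obtain d1 where d1: "d1 > 0" "\<And>y. dist y x < d1 \<Longrightarrow> dist (?P y) (?P x) < \<epsilon> / 2"
      using \<open>\<epsilon> > 0\<close> unfolding continuous_at_eps_delta by (meson half_gt_zero)
    from cont(2) obtain d2 where d2: "d2 > 0" "\<And>y. dist y x < d2 \<Longrightarrow> dist (?Q y) (?Q x) < \<epsilon> / 2"
      using \<open>\<epsilon> > 0\<close> unfolding continuous_at_eps_delta by (meson half_gt_zero)
    \<comment> \<open>Halved because the intermediate points are displaced by less than h along each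
      of two axes.\<close>
    define h where "h = min d1 d2 / 2"
    have h: "h > 0" using d1 d2 by (simp add: h_def)
    have near: "dist (x + \<xi> *\<^sub>R axis k 1 + \<eta> *\<^sub>R axis l 1) x < min d1 d2"
      if "0 < \<xi>" "\<xi> < h" "0 < \<eta>" "\<eta> < h" for \<xi> \<eta> k l
    proof -
      have "dist (x + \<xi> *\<^sub>R axis k 1 + \<eta> *\<^sub>R axis l 1) x
              = norm (\<xi> *\<^sub>R axis k 1 + \<eta> *\<^sub>R axis l (1 :: real) :: real ^ 'd)"
        by (simp add: dist_norm add.assoc)
      also have "\<dots> \<le> norm (\<xi> *\<^sub>R axis k (1 :: real) :: real ^ 'd) + norm (\<eta> *\<^sub>R axis l (1 :: real) :: real ^ 'd)"
        by (rule norm_triangle_ineq)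
      also have "\<dots> < min d1 d2" using that by (simp add: h_def)
      finally show ?thesis .
    qed
    obtain \<xi> \<eta> where 1: "0 < \<xi>" "\<xi> < h" "0 < \<eta>" "\<eta> < h"
      "f (x + h *\<^sub>R axis i 1 + h *\<^sub>R axis j 1) - f (x + h *\<^sub>R axis i 1) - f (x + h *\<^sub>R axis j 1) + f x
         = h * h * ?Q (x + \<xi> *\<^sub>R axis i 1 + \<eta> *\<^sub>R axis j 1)"
      using second_difference_eq_partial[OF assms h] by blast
    obtain \<xi>' \<eta>' where 2: "0 < \<xi>'" "\<xi>' < h" "0 < \<eta>'" "\<eta>' < h"
      "f (x + h *\<^sub>R axis j 1 + h *\<^sub>R axis i 1) - f (x + h *\<^sub>R axis j 1) - f (x + h *\<^sub>R axis i 1) + f x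
         = h * h * ?P (x + \<xi>' *\<^sub>R axis j 1 + \<eta>' *\<^sub>R axis i 1)"
      using second_difference_eq_partial[OF assms h] by blast
    let ?p = "x + \<xi>' *\<^sub>R axis j 1 + \<eta>' *\<^sub>R axis i 1" and ?q = "x + \<xi> *\<^sub>R axis i 1 + \<eta> *\<^sub>R axis j 1"
    have "h * h * ?P ?p = h * h * ?Q ?q"
      using 1(5) 2(5) by (simp only: add.assoc[of x] add.commute[of "h *\<^sub>R axis j 1" "h *\<^sub>R axis i 1"])
    then have "?P ?p = ?Q ?q" using h by simp
    moreover have "dist (?P ?p) (?P x) < \<epsilon> / 2"
      by (rule d1(2)) (use near[OF 2(1-4)] in simp)
    moreover have "dist (?Q ?q) (?Q x) < \<epsilon> / 2"
      by (rule d2(2)) (use near[OF 1(1-4)] in simp)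
    ultimately show ?thesis unfolding dist_real_def by linarith
  qed
  then have "\<bar>?P x - ?Q x\<bar> \<le> 0" by (rule field_le_epsilon[of _ 0, simplified])
  then show "?P x = ?Q x" by simp
qed

lemma partial_foldr_partial_append:
  assumes "smooth f"
  shows "partial k (foldr partial (us @ vs) f) = foldr partial (us @ k # vs) f"
proof (induction us)
  case (Cons u us)
  then show ?case
    using partial_commute[OF smooth_foldr_partial[OF assms], of k u "us @ vs"] by simp
qed simp

text \<open>Commutation lets the head of one list move to its position in the other. Hence only the
  number of derivatives per direction matters, and the arbitrary choice of \<open>coords\<close> is
  harmless.\<close>

lemma foldr_partial_mset_eq:
  assumes "smooth f" "mset ks = mset ks'"
  shows "foldr partial ks f = foldr partial ks' f"
  using assms(2)
proof (induction ks arbitrary: ks')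
  case (Cons k ks)
  then have "k \<in> set ks'" by (metis list.set_intros(1) set_mset_mset)
  then obtain us vs where "ks' = us @ k # vs" by (meson split_list)
  with Cons.IH[of "us @ vs"] Cons.prems have "foldr partial ks f = foldr partial (us @ vs) f" by simp
  with \<open>ks' = _\<close> show ?case
    using partial_foldr_partial_append[OF assms(1), of k us vs] by simp
qed simp

text \<open>Flattens the nested powers in \<open>mixed_partial\<close> into one list of directions,
  the form in which \<open>smooth\<close> speaks of derivatives.\<close>

definition directions :: "nat ^ 'd::finite \<Rightarrow> 'd list" where
  "directions s = concat (map (\<lambda>k. replicate (s $ k) k) coords)"

lemma mixed_partial_eq_foldr: "mixed_partial s f = foldr partial (directions s) f"
proof -
  have "foldr (\<lambda>k. partial k ^^ (s $ k)) ks f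
      = foldr partial (concat (map (\<lambda>k. replicate (s $ k) k) ks)) f" for ks
    by (induction ks) simp_all
  then show ?thesis by (simp add: mixed_partial_def directions_def)
qed

lemma count_directions:
  fixes s :: "nat ^ 'd::finite"
  shows "count (mset (directions s)) k = s $ k"
proof -
  have *: "count (mset (concat (map (\<lambda>k. replicate (s $ k) k) ks))) k = (if k \<in> set ks then s $ k else 0)"
    if "distinct ks" for ks
    using that by (induction ks) auto
  show ?thesis using *[OF coords(1)] coords(2)[where 'd = 'd] by (simp add: directions_def)
qed

lemma smooth_mixed_partial: "smooth f \<Longrightarrow> smooth (mixed_partial s f)"
  by (simp add: mixed_partial_eq_foldr smooth_foldr_partial)

lemma partial_mixed_partial:
  assumes "smooth f"
  shows "partial k (mixed_partial s f) = mixed_partial (s + axis k 1) f"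
proof -
  have "mset (k # directions s) = mset (directions (s + axis k 1))"
    by (rule multiset_eqI) (simp only: mset.simps count_add_mset count_directions, simp add: axis_def)
  from foldr_partial_mset_eq[OF assms this] show ?thesis
    by (simp add: mixed_partial_eq_foldr)
qed

lemma partial_sum_mixed_partial:
  assumes "smooth f" "finite B"
  shows "partial k (\<lambda>x. \<Sum>\<beta>\<in>B. c \<beta> * mixed_partial (\<sigma> \<beta>) f x)
           = (\<lambda>x. \<Sum>\<beta>\<in>B. c \<beta> * mixed_partial (\<sigma> \<beta> + axis k 1) f x)"
proof
  fix x
  have "((\<lambda>t. \<Sum>\<beta>\<in>B. c \<beta> * mixed_partial (\<sigma> \<beta>) f (x + t *\<^sub>R axis k 1)) has_field_derivative
          (\<Sum>\<beta>\<in>B. c \<beta> * partial k (mixed_partial (\<sigma> \<beta>) f) (x + 0 *\<^sub>R axis k 1))) (at 0)"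
    by (intro DERIV_sum DERIV_cmult has_field_derivative_partial smoothD smooth_mixed_partial assms)
  then show "partial k (\<lambda>x. \<Sum>\<beta>\<in>B. c \<beta> * mixed_partial (\<sigma> \<beta>) f x) x
           = (\<Sum>\<beta>\<in>B. c \<beta> * mixed_partial (\<sigma> \<beta> + axis k 1) f x)"
    unfolding partial_def[of k "\<lambda>x. \<Sum>\<beta>\<in>B. c \<beta> * mixed_partial (\<sigma> \<beta>) f x"]
    by (simp add: DERIV_imp_deriv partial_mixed_partial assms)
qed

text \<open>This is the multinomial theorem for the commuting operators \<partial>_k^2. It serves
  twice: for f, and for the Gaussian in the Laplacian Hermite polynomials.\<close>

lemma laplacian_power_mixed_partial:
  assumes "smooth f"
  shows "(laplacian ^^ j) (mixed_partial s f)
           = (\<lambda>x. \<Sum>\<beta> | msize \<beta> = j. fact j / mfact \<beta> * mixed_partial (s + \<beta> + \<beta>) f x)"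
proof (induction j)
  case 0
  have "{\<beta> :: nat ^ 'a. msize \<beta> = 0} = {0}" by (auto simp: msize_eq_0_iff)
  then show ?case by (simp add: mfact_def fun_eq_iff)
next
  case (Suc j)
  show ?case
  proof
    fix x
    have "(laplacian ^^ Suc j) (mixed_partial s f) x
        = (\<Sum>k\<in>UNIV. \<Sum>\<beta> | msize \<beta> = j. fact j / mfact \<beta> *
             mixed_partial (s + \<beta> + \<beta> + axis k 1 + axis k 1) f x)"
      by (simp only: funpow.simps o_apply Suc.IH laplacian_def
            partial_sum_mixed_partial[OF assms finite_msize_eq])
    also have "\<dots> = (\<Sum>\<beta> | msize \<beta> = Suc j. fact (Suc j) / mfact \<beta> * mixed_partial (s + \<beta> + \<beta>) f x)"
      by (subst sum_multinomial_Suc) (simp add: add_ac)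
    finally show "(laplacian ^^ Suc j) (mixed_partial s f) x
        = (\<Sum>\<beta> | msize \<beta> = Suc j. fact (Suc j) / mfact \<beta> * mixed_partial (s + \<beta> + \<beta>) f x)" .
  qed
qed

section \<open>Derivatives of the multivariate Gaussian\<close>

lemma has_field_derivative_prod_axis:
  fixes y :: "real ^ 'd::finite"
  assumes "(u k has_field_derivative u') (at (y $ k))"
  shows "((\<lambda>t. \<Prod>m\<in>UNIV. u m ((y + t *\<^sub>R axis k 1) $ m)) has_field_derivative
           u' * (\<Prod>m\<in>UNIV - {k}. u m (y $ m))) (at 0)"
proof -
  have eq: "(\<Prod>m\<in>UNIV. u m ((y + t *\<^sub>R axis k 1) $ m))
      = u k (y $ k + t) * (\<Prod>m\<in>UNIV - {k}. u m (y $ m))" for t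
    by (subst prod.remove[of _ k]) (auto simp: axis_def intro!: prod.cong)
  have "((\<lambda>t. u k (y $ k + t)) has_field_derivative u') (at 0)"
    using assms DERIV_shift[of "u k" u' 0 "y $ k"] by (simp add: add.commute)
  then show ?thesis unfolding eq by (rule DERIV_cmult_right)
qed

text \<open>Stated for lists of directions because it must yield smoothness of the Gaussian before
  commutation can be applied to it. Each derivative acts on one factor only.\<close>

lemma foldr_partial_gauss:
  "foldr partial ks (\<lambda>y. exp (- (norm y)\<^sup>2 / 2))
     = (\<lambda>y :: real ^ 'd::finite. \<Prod>k\<in>UNIV. (deriv ^^ count (mset ks) k) (\<lambda>t. exp (- t\<^sup>2 / 2)) (y $ k))"
proof (induction ks)
  case Nil
  have "exp (- (norm y)\<^sup>2 / 2) = (\<Prod>k\<in>UNIV. exp (- (y $ k)\<^sup>2 / 2))" for y :: "real ^ 'd"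
  proof -
    have "(norm y)\<^sup>2 = (\<Sum>k\<in>UNIV. (y $ k)\<^sup>2)"
      unfolding power2_norm_eq_inner inner_vec_def by (simp add: power2_eq_square)
    then show ?thesis
      by (simp only: sum_negf[symmetric] sum_divide_distrib exp_sum finite)
  qed
  then show ?case by simp
next
  case (Cons k ks)
  let ?g = "\<lambda>t :: real. exp (- t\<^sup>2 / 2)"
  show ?case
  proof
    fix y :: "real ^ 'd"
    have "partial k (\<lambda>y. \<Prod>m\<in>UNIV. (deriv ^^ count (mset ks) m) ?g (y $ m)) y
        = (deriv ^^ Suc (count (mset ks) k)) ?g (y $ k)
            * (\<Prod>m\<in>UNIV - {k}. (deriv ^^ count (mset ks) m) ?g (y $ m))"
      unfolding partial_def
      by (rule DERIV_imp_deriv,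
          rule has_field_derivative_prod_axis[of "\<lambda>m. (deriv ^^ count (mset ks) m) ?g"],
          rule has_field_derivative_higher_deriv_gauss)
    also have "\<dots> = (\<Prod>m\<in>UNIV. (deriv ^^ count (mset (k # ks)) m) ?g (y $ m))"
      by (subst (2) prod.remove[of _ k]) (auto intro!: prod.cong)
    finally show "foldr partial (k # ks) (\<lambda>y. exp (- (norm y)\<^sup>2 / 2)) y
        = (\<Prod>m\<in>UNIV. (deriv ^^ count (mset (k # ks)) m) ?g (y $ m))"
      by (simp only: foldr.simps o_apply Cons.IH)
  qed
qed

lemma smooth_gauss: "smooth (\<lambda>y :: real ^ 'd::finite. exp (- (norm y)\<^sup>2 / 2))"
  unfolding smooth_def
proof (intro allI conjI)
  fix ks :: "'d list"
  show "continuous_on UNIV (foldr partial ks (\<lambda>y. exp (- (norm y)\<^sup>2 / 2)))"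
    unfolding foldr_partial_gauss higher_deriv_gauss
    by (intro continuous_intros) auto
  fix k :: 'd and y :: "real ^ 'd"
  show "has_partial_at k (foldr partial ks (\<lambda>y. exp (- (norm y)\<^sup>2 / 2))) y"
    unfolding has_partial_at_def foldr_partial_gauss real_differentiable_def
    by (rule exI, rule has_field_derivative_prod_axis[of
         "\<lambda>m. (deriv ^^ count (mset ks) m) (\<lambda>t. exp (- t\<^sup>2 / 2))"],
        rule has_field_derivative_higher_deriv_gauss)
qed

text \<open>The signs match because the extra order 2\<beta> is even. Each product on the right has
  total degree |s| + 2j, which feeds the later degree count.\<close>

lemma laplacian_hermite_eq:
  "laplacian_hermite s j y
     = (\<Sum>\<beta> | msize \<beta> = j. fact j / mfact \<beta> *
          (\<Prod>k\<in>UNIV. poly (hermite_poly (s $ k + 2 * \<beta> $ k)) (y $ k)))"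
proof -
  have eq: "(\<Prod>k\<in>UNIV. exp (- (y $ k)\<^sup>2 / 2)) = exp (- (norm y)\<^sup>2 / 2)"
    using fun_cong[OF foldr_partial_gauss[of "[]"], of y] by simp
  have gauss: "exp ((norm y)\<^sup>2 / 2) * (\<Prod>k\<in>UNIV. exp (- (y $ k)\<^sup>2 / 2)) = 1"
    unfolding eq by (simp flip: exp_add)
  have summand: "(- 1) ^ msize s * exp ((norm y)\<^sup>2 / 2)
        * mixed_partial (s + \<beta> + \<beta>) (\<lambda>y. exp (- (norm y)\<^sup>2 / 2)) y
      = (\<Prod>k\<in>UNIV. poly (hermite_poly (s $ k + 2 * \<beta> $ k)) (y $ k))" for \<beta>
  proof -
    have "mixed_partial (s + \<beta> + \<beta>) (\<lambda>y. exp (- (norm y)\<^sup>2 / 2)) y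
        = (\<Prod>k\<in>UNIV. (- 1) ^ (s $ k) * poly (hermite_poly (s $ k + 2 * \<beta> $ k)) (y $ k)
            * exp (- (y $ k)\<^sup>2 / 2))"
      unfolding mixed_partial_eq_foldr foldr_partial_gauss count_directions higher_deriv_gauss
      by (simp add: add.assoc power_add mult_2[symmetric])
    also have "\<dots> = (- 1) ^ msize s * (\<Prod>k\<in>UNIV. poly (hermite_poly (s $ k + 2 * \<beta> $ k)) (y $ k))
            * (\<Prod>k\<in>UNIV. exp (- (y $ k)\<^sup>2 / 2))"
      by (simp only: prod.distrib msize_def power_sum)
    finally show ?thesis
      using gauss by (simp add: mult_ac flip: power_mult_distrib)
  qed
  have "laplacian_hermite s j y
     = (\<Sum>\<beta> | msize \<beta> = j. fact j / mfact \<beta> * ((- 1) ^ msize s * exp ((norm y)\<^sup>2 / 2)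
        * mixed_partial (s + \<beta> + \<beta>) (\<lambda>y. exp (- (norm y)\<^sup>2 / 2)) y))"
    unfolding laplacian_hermite_def laplacian_power_mixed_partial[OF smooth_gauss]
    by (simp add: sum_distrib_left mult_ac)
  then show ?thesis by (simp only: summand)
qed

section \<open>Exactness of the cubature rule\<close>

text \<open>Lebesgue measure on \<open>real ^ 'd\<close> is the image of a product measure indexed
  by \<open>Basis\<close>. Identifying basis vectors with coordinates through
  \<open>axis_index\<close> reduces the claim to Fubini for that product.\<close>

lemma lborel_integral_prod_vec:
  fixes g :: "'d::finite \<Rightarrow> real \<Rightarrow> real"
  assumes "\<And>k. integrable lborel (g k)"
  shows "(LINT x|(lborel :: (real ^ 'd) measure). (\<Prod>k\<in>UNIV. g k (x $ k)))
           = (\<Prod>k\<in>UNIV. (LINT y|lborel. g k y))"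
proof -
  interpret product_sigma_finite "\<lambda>b :: real ^ 'd. lborel :: real measure" ..
  let ?T = "\<lambda>f :: real ^ 'd \<Rightarrow> real. \<Sum>b\<in>Basis. f b *\<^sub>R b"
  have Basis_eq: "(Basis :: (real ^ 'd) set) = range (\<lambda>k. axis k 1)"
    by (auto simp: Basis_vec_def)
  have inj: "inj (\<lambda>k. axis k (1 :: real) :: real ^ 'd)"
    by (auto simp: inj_on_def axis_eq_axis)
  have prod_Basis: "prod F Basis = (\<Prod>k\<in>UNIV. F (axis k 1))" for F :: "real ^ 'd \<Rightarrow> real"
    by (simp add: Basis_eq prod.reindex[OF inj])
  have index: "axis_index (axis k 1 :: real ^ 'd) = k" for k
    unfolding axis_index_def by (rule some_equality) (auto simp: axis_eq_axis)
  have nth: "?T f $ k = f (axis k 1)" for f k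
    by (simp add: cart_eq_inner_axis)
  have [measurable]: "g k \<in> borel_measurable borel" for k
    using borel_measurable_integrable[OF assms] by simp
  have [measurable]: "(\<lambda>x :: real ^ 'd. x $ k) \<in> borel_measurable borel" for k
    by (intro borel_measurable_continuous_onI continuous_intros)
  have "(LINT x|(lborel :: (real ^ 'd) measure). (\<Prod>k\<in>UNIV. g k (x $ k)))
      = (LINT f|(\<Pi>\<^sub>M b\<in>Basis. lborel). (\<Prod>k\<in>UNIV. g k (?T f $ k)))"
    by (subst lborel_eq, rule integral_distr) measurable
  also have "\<dots> = (LINT f|(\<Pi>\<^sub>M b\<in>Basis. lborel). (\<Prod>b\<in>(Basis :: (real ^ 'd) set). g (axis_index b) (f b)))"
    by (simp only: nth prod_Basis index)
  also have "\<dots> = (\<Prod>b\<in>(Basis :: (real ^ 'd) set). (LINT y|lborel. g (axis_index b) y))"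
    by (rule product_integral_prod) (auto intro: assms)
  also have "\<dots> = (\<Prod>k\<in>UNIV. (LINT y|lborel. g k y))"
    by (simp only: prod_Basis index)
  finally show ?thesis .
qed

lemma prod_sum_mult_vec:
  fixes c m :: "'d::finite \<Rightarrow> nat \<Rightarrow> 'a::comm_semiring_1"
  shows "(\<Prod>k\<in>UNIV. \<Sum>b\<le>\<delta> $ k. c k b * m k b)
     = (\<Sum>\<gamma> | \<forall>k. \<gamma> $ k \<le> \<delta> $ k. (\<Prod>k\<in>UNIV. c k (\<gamma> $ k)) * (\<Prod>k\<in>UNIV. m k (\<gamma> $ k)))"
  by (simp add: prod_sum_vec prod.distrib)

text \<open>Together with \<open>prod_gauss_expect_eq\<close> this expands both sides of the
  cubature rule over the same box with the same coefficients, so that only monomials need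
  comparison.\<close>

lemma sum_prod_poly_eq:
  fixes q :: "'d::finite \<Rightarrow> real poly" and y :: "'i \<Rightarrow> real ^ 'd"
  assumes "\<And>k. degree (q k) \<le> \<delta> $ k"
  shows "(\<Sum>i\<in>\<Omega>. w i * (\<Prod>k\<in>UNIV. poly (q k) (y i $ k)))
     = (\<Sum>\<gamma> | \<forall>k. \<gamma> $ k \<le> \<delta> $ k. (\<Prod>k\<in>UNIV. coeff (q k) (\<gamma> $ k)) *
          (\<Sum>i\<in>\<Omega>. w i * (\<Prod>k\<in>UNIV. (y i $ k) ^ (\<gamma> $ k))))"
proof -
  have "(\<Sum>i\<in>\<Omega>. w i * (\<Prod>k\<in>UNIV. poly (q k) (y i $ k)))
      = (\<Sum>i\<in>\<Omega>. \<Sum>\<gamma> | \<forall>k. \<gamma> $ k \<le> \<delta> $ k. w i *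
          ((\<Prod>k\<in>UNIV. coeff (q k) (\<gamma> $ k)) * (\<Prod>k\<in>UNIV. (y i $ k) ^ (\<gamma> $ k))))"
    by (simp only: poly_eq_sum_of_degree_le[OF assms] prod_sum_mult_vec sum_distrib_left)
  also have "\<dots> = (\<Sum>\<gamma> | \<forall>k. \<gamma> $ k \<le> \<delta> $ k. \<Sum>i\<in>\<Omega>. w i *
          ((\<Prod>k\<in>UNIV. coeff (q k) (\<gamma> $ k)) * (\<Prod>k\<in>UNIV. (y i $ k) ^ (\<gamma> $ k))))"
    by (rule sum.swap)
  finally show ?thesis by (simp only: sum_distrib_left mult.left_commute)
qed

lemma prod_gauss_expect_eq:
  fixes q :: "'d::finite \<Rightarrow> real poly"
  assumes "\<And>k. degree (q k) \<le> \<delta> $ k"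
  shows "(\<Prod>k\<in>UNIV. gauss_expect (q k))
     = (\<Sum>\<gamma> | \<forall>k. \<gamma> $ k \<le> \<delta> $ k. (\<Prod>k\<in>UNIV. coeff (q k) (\<gamma> $ k)) *
          (\<Prod>k\<in>UNIV. gauss_moment (\<gamma> $ k)))"
  by (simp only: gauss_expect_eq_sum[OF assms] prod_sum_mult_vec)

text \<open>Reflecting coordinate m maps \<Omega> onto itself and negates every summand, so the sum
  equals its own negative.\<close>

lemma sum_prod_power_odd_eq_0:
  fixes \<Omega> :: "(int ^ 'd::finite) set"
  assumes "flip_sign m ` \<Omega> = \<Omega>" "\<And>i. i \<in> \<Omega> \<Longrightarrow> w (flip_sign m i) = w i" "odd (\<alpha> $ m)"
  shows "(\<Sum>i\<in>\<Omega>. w i * (\<Prod>k\<in>UNIV. ((a *\<^sub>R rvec i) $ k) ^ (\<alpha> $ k))) = (0 :: real)"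
proof -
  let ?F = "\<lambda>i. w i * (\<Prod>k\<in>UNIV. ((a *\<^sub>R rvec i) $ k) ^ (\<alpha> $ k))"
  have inj: "inj (flip_sign m :: int ^ 'd \<Rightarrow> _)"
    by (rule inj_on_inverseI[of _ "flip_sign m"]) (simp add: flip_sign_def vec_eq_iff)
  have flip: "?F (flip_sign m i) = - ?F i" if "i \<in> \<Omega>" for i
  proof -
    have "(\<Prod>k\<in>UNIV - {m}. ((a *\<^sub>R rvec (flip_sign m i)) $ k) ^ (\<alpha> $ k))
        = (\<Prod>k\<in>UNIV - {m}. ((a *\<^sub>R rvec i) $ k) ^ (\<alpha> $ k))"
      by (rule prod.cong) (auto simp: flip_sign_def rvec_def)
    moreover have "((a *\<^sub>R rvec (flip_sign m i)) $ m) ^ (\<alpha> $ m) = - (((a *\<^sub>R rvec i) $ m) ^ (\<alpha> $ m))"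
      using assms(3) by (simp add: flip_sign_def rvec_def)
    ultimately have "(\<Prod>k\<in>UNIV. ((a *\<^sub>R rvec (flip_sign m i)) $ k) ^ (\<alpha> $ k))
        = - (\<Prod>k\<in>UNIV. ((a *\<^sub>R rvec i) $ k) ^ (\<alpha> $ k))"
      by (simp only: prod.remove[OF finite UNIV_I[of m]])
    then show ?thesis using assms(2)[OF that] by simp
  qed
  have "sum ?F \<Omega> = sum ?F (flip_sign m ` \<Omega>)" by (simp only: assms(1))
  also have "\<dots> = (\<Sum>i\<in>\<Omega>. ?F (flip_sign m i))"
    by (rule sum.reindex[unfolded o_def]) (rule inj_on_subset[OF inj subset_UNIV])
  also have "\<dots> = - sum ?F \<Omega>"
    unfolding sum_negf[symmetric] by (rule sum.cong[OF refl flip])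
  finally show ?thesis by simp
qed

text \<open>The norm conditions reach the even monomials up to degree 2N. Degree 2N + 1 comes for
  free, because a multi-index of odd size has an odd entry.\<close>

lemma quadrature_moment:
  fixes \<Omega> :: "(int ^ 'd::finite) set"
  assumes "invariant_weights \<Omega> w" "hermite_norm_preserving N a \<Omega> w"
    and "msize \<alpha> \<le> 2 * N + 1"
  shows "(\<Sum>i\<in>\<Omega>. w i * (\<Prod>k\<in>UNIV. ((a *\<^sub>R rvec i) $ k) ^ (\<alpha> $ k)))
           = (\<Prod>k\<in>UNIV. gauss_moment (\<alpha> $ k))"
  using assms(3)
proof (induction "msize \<alpha>" arbitrary: \<alpha> rule: less_induct)
  case less
  let ?S = "\<lambda>\<gamma>. \<Sum>i\<in>\<Omega>. w i * (\<Prod>k\<in>UNIV. ((a *\<^sub>R rvec i) $ k) ^ (\<gamma> $ k))"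
  let ?M = "\<lambda>\<gamma> :: nat ^ 'd. \<Prod>k\<in>UNIV. gauss_moment (\<gamma> $ k)"
  show ?case
  proof (cases "\<exists>m. odd (\<alpha> $ m)")
    case True
    then obtain m where m: "odd (\<alpha> $ m)" by blast
    have "?M \<alpha> = 0" using gauss_moment_odd[OF m] by auto
    moreover have "?S \<alpha> = 0"
      by (rule sum_prod_power_odd_eq_0[OF _ _ m])
         (use assms(1) in \<open>simp_all add: invariant_weights_def\<close>)
    ultimately show ?thesis by simp
  next
    case False
    define \<beta> where "\<beta> = (\<chi> k. \<alpha> $ k div 2)"
    have \<alpha>: "\<alpha> $ k = \<beta> $ k + \<beta> $ k" for k
      using False by (simp add: \<beta>_def mult_2[symmetric])
    then have "\<alpha> = \<beta> + \<beta>" by (simp add: vec_eq_iff)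
    then have \<beta>_le: "msize \<beta> \<le> N" using less.prems by (simp add: msize_add)
    let ?q = "\<lambda>k. hermite_poly (\<beta> $ k) * hermite_poly (\<beta> $ k)"
    have deg: "degree (?q k) \<le> \<alpha> $ k" for k
      using degree_mult_le[of "hermite_poly (\<beta> $ k)" "hermite_poly (\<beta> $ k)"]
      by (simp add: \<alpha> degree_hermite_poly)
    have lead: "coeff (?q k) (\<alpha> $ k) = 1" for k
      using coeff_mult_degree_sum[of "hermite_poly (\<beta> $ k)" "hermite_poly (\<beta> $ k)"]
      by (simp add: \<alpha> degree_hermite_poly coeff_hermite_poly_self)
    let ?c = "\<lambda>\<gamma>. \<Prod>k\<in>UNIV. coeff (?q k) (\<gamma> $ k)" and ?A = "{\<gamma>. \<forall>k. \<gamma> $ k \<le> \<alpha> $ k}"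
    have "(\<Sum>\<gamma>\<in>?A. ?c \<gamma> * ?S \<gamma>) = (\<Sum>i\<in>\<Omega>. w i * (\<Prod>k\<in>UNIV. poly (?q k) ((a *\<^sub>R rvec i) $ k)))"
      by (rule sum_prod_poly_eq[OF deg, symmetric])
    also have "\<dots> = (\<Sum>i\<in>\<Omega>. w i * (mhermite \<beta> (a *\<^sub>R rvec i))\<^sup>2)"
      by (simp add: mhermite_def hermite_eq_poly prod.distrib power2_eq_square)
    also have "\<dots> = (LINT x|(lborel :: (real ^ 'd) measure).
               (\<Prod>k\<in>UNIV. poly (?q k) (x $ k) * std_normal_density (x $ k)))"
      using assms(2) \<beta>_le by (simp add: hermite_norm_preserving_def hermite_eq_poly power2_eq_square)
    also have "\<dots> = (\<Prod>k\<in>UNIV. gauss_expect (?q k))"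
      unfolding gauss_expect_def by (rule lborel_integral_prod_vec) (rule integrable_poly_gauss)
    also have "\<dots> = (\<Sum>\<gamma>\<in>?A. ?c \<gamma> * ?M \<gamma>)"
      by (rule prod_gauss_expect_eq[OF deg])
    finally have eq: "(\<Sum>\<gamma>\<in>?A. ?c \<gamma> * ?S \<gamma>) = (\<Sum>\<gamma>\<in>?A. ?c \<gamma> * ?M \<gamma>)" .
    \<comment> \<open>Every \<gamma> in the box other than \<alpha> has smaller size, so the
      induction hypothesis cancels all terms but the leading one, whose coefficient is 1.\<close>
    have lower: "(\<Sum>\<gamma>\<in>?A - {\<alpha>}. ?c \<gamma> * ?S \<gamma>) = (\<Sum>\<gamma>\<in>?A - {\<alpha>}. ?c \<gamma> * ?M \<gamma>)"
    proof (rule sum.cong[OF refl])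
      fix \<gamma> assume \<gamma>: "\<gamma> \<in> ?A - {\<alpha>}"
      then obtain k where "\<gamma> $ k < \<alpha> $ k" by (auto simp: vec_eq_iff nat_less_le)
      with \<gamma> have "msize \<gamma> < msize \<alpha>"
        unfolding msize_def by (intro sum_strict_mono_ex1) auto
      with less show "?c \<gamma> * ?S \<gamma> = ?c \<gamma> * ?M \<gamma>" by simp
    qed
    have "?c \<alpha> = 1" by (simp only: lead prod.neutral_const)
    with eq lower show ?thesis
      by (simp only: sum.remove[OF finite_vec_le, of \<alpha> \<alpha>, simplified])
  qed
qed

lemma quadrature_poly:
  fixes \<Omega> :: "(int ^ 'd::finite) set"
  assumes "invariant_weights \<Omega> w" "hermite_norm_preserving N a \<Omega> w"
    and "(\<Sum>k\<in>UNIV. degree (q k)) \<le> 2 * N + 1"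
  shows "(\<Sum>i\<in>\<Omega>. w i * (\<Prod>k\<in>UNIV. poly (q k) ((a *\<^sub>R rvec i) $ k)))
           = (\<Prod>k\<in>UNIV. gauss_expect (q k))"
proof -
  let ?\<delta> = "\<chi> k. degree (q k)"
  have deg: "degree (q k) \<le> ?\<delta> $ k" for k by simp
  have "msize \<gamma> \<le> 2 * N + 1" if "\<gamma> \<in> {\<gamma>. \<forall>k. \<gamma> $ k \<le> ?\<delta> $ k}" for \<gamma>
    using that by (intro order_trans[OF _ assms(3)]) (auto simp: msize_def intro: sum_mono)
  note moment = quadrature_moment[OF assms(1,2) this]
  show ?thesis
    unfolding sum_prod_poly_eq[OF deg] prod_gauss_expect_eq[OF deg]
    by (rule sum.cong[OF refl]) (simp only: moment)
qed

section \<open>Asymptotic expansion\<close>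

text \<open>For 0 \<le> h \<le> 1 each tail term is at most h^m times its absolute value at h = 1.
  Unordered summability of reals is absolute, so the resulting constant is finite and independent of
  h.\<close>

lemma norm_has_sum_diff_bound:
  fixes c :: "'i \<Rightarrow> real"
  assumes "((\<lambda>\<alpha>. c \<alpha> * h ^ e \<alpha>) has_sum S) UNIV" "c summable_on UNIV" "finite A"
    and "\<And>\<alpha>. \<alpha> \<notin> A \<Longrightarrow> m \<le> e \<alpha>" and "0 \<le> h" "h \<le> 1"
  shows "\<bar>S - (\<Sum>\<alpha>\<in>A. c \<alpha> * h ^ e \<alpha>)\<bar> \<le> (\<Sum>\<^sub>\<infinity>\<alpha>. \<bar>c \<alpha>\<bar>) * h ^ m"
proof -
  let ?t = "\<lambda>\<alpha>. c \<alpha> * h ^ e \<alpha>"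
  have tail: "(?t has_sum (S - sum ?t A)) (UNIV - A)"
    by (rule has_sum_Diff[OF assms(1) has_sum_finite[OF assms(3)]]) simp
  have "?t summable_on UNIV - A" using tail by (auto simp: summable_on_def)
  then have "(\<lambda>\<alpha>. norm (?t \<alpha>)) summable_on UNIV - A"
    by (rule summable_on_iff_abs_summable_on_real[THEN iffD1])
  then have tail_abs: "((\<lambda>\<alpha>. norm (?t \<alpha>)) has_sum (\<Sum>\<^sub>\<infinity>\<alpha>\<in>UNIV - A. norm (?t \<alpha>))) (UNIV - A)"
    by (rule has_sum_infsum)
  have c_abs: "((\<lambda>\<alpha>. \<bar>c \<alpha>\<bar>) has_sum (\<Sum>\<^sub>\<infinity>\<alpha>. \<bar>c \<alpha>\<bar>)) UNIV"
    using has_sum_infsum[OF summable_on_iff_abs_summable_on_real[THEN iffD1, OF assms(2)]]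
    by (simp only: real_norm_def)
  have "norm (S - sum ?t A) \<le> (\<Sum>\<^sub>\<infinity>\<alpha>\<in>UNIV - A. norm (?t \<alpha>))"
    by (rule norm_has_sum_bound[OF tail_abs tail])
  also have "\<dots> \<le> h ^ m * (\<Sum>\<^sub>\<infinity>\<alpha>. \<bar>c \<alpha>\<bar>)"
  proof (rule has_sum_mono_neutral[OF tail_abs has_sum_cmult_right[OF c_abs]])
    fix \<alpha> assume "\<alpha> \<in> (UNIV - A) \<inter> UNIV"
    then have "h ^ e \<alpha> \<le> h ^ m" using assms(4-6) by (intro power_decreasing) auto
    then show "norm (?t \<alpha>) \<le> h ^ m * \<bar>c \<alpha>\<bar>"
      using \<open>0 \<le> h\<close> by (simp add: abs_mult mult.commute mult_left_mono)
  qed (use \<open>0 \<le> h\<close> in auto)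
  finally show ?thesis by (simp add: mult.commute)
qed

text \<open>Along the ray x + hv the Taylor series is a power series in h. Its convergence at h = 1
  supplies the summable majorant, so no remainder formula is involved.\<close>

lemma taylor_remainder_bigo:
  fixes f :: "real ^ 'd::finite \<Rightarrow> real"
  assumes "taylor_converges f"
  shows "(\<lambda>h. f (x + h *\<^sub>R v)
            - (\<Sum>\<alpha> | msize \<alpha> \<le> M. mixed_partial \<alpha> f x / mfact \<alpha> * (\<Prod>k\<in>UNIV. (v $ k) ^ (\<alpha> $ k)) * h ^ msize \<alpha>))
           \<in> O[at_right 0](\<lambda>h. h ^ Suc M)"
proof -
  let ?c = "\<lambda>\<alpha>. mixed_partial \<alpha> f x / mfact \<alpha> * (\<Prod>k\<in>UNIV. (v $ k) ^ (\<alpha> $ k))"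
  have series: "((\<lambda>\<alpha>. ?c \<alpha> * h ^ msize \<alpha>) has_sum f (x + h *\<^sub>R v)) UNIV" for h
  proof -
    have "(\<Prod>k\<in>UNIV. ((x + h *\<^sub>R v) $ k - x $ k) ^ (\<alpha> $ k))
        = (\<Prod>k\<in>UNIV. (v $ k) ^ (\<alpha> $ k)) * h ^ msize \<alpha>" for \<alpha> :: "nat ^ 'd"
      by (simp add: power_mult_distrib prod.distrib msize_def power_sum mult.commute)
    then show ?thesis
      using assms[unfolded taylor_converges_def, rule_format, of x "x + h *\<^sub>R v"]
      by (simp only: mfact_def mult.assoc)
  qed
  from series[of 1] have "?c summable_on UNIV" by (auto simp: summable_on_def)
  note bound = norm_has_sum_diff_bound[OF series this finite_msize_le[of M], where m = "Suc M"]
  show ?thesis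
  proof (rule bigoI[of _ "\<Sum>\<^sub>\<infinity>\<alpha>. \<bar>?c \<alpha>\<bar>"])
    have "eventually (\<lambda>h :: real. h \<in> {0<..<1}) (at_right 0)"
      by (rule eventually_at_right_real) simp
    then show "\<forall>\<^sub>F h in at_right 0. norm (f (x + h *\<^sub>R v) - (\<Sum>\<alpha> | msize \<alpha> \<le> M. ?c \<alpha> * h ^ msize \<alpha>))
        \<le> (\<Sum>\<^sub>\<infinity>\<alpha>. \<bar>?c \<alpha>\<bar>) * norm (h ^ Suc M)"
    proof eventually_elim
      case (elim h)
      then show ?case using bound[of h] by (simp add: not_le Suc_le_eq)
    qed
  qed
qed

text \<open>Up to sign and division by the Gaussian, this is the exponential series of -\<Delta>/2,
  cut off after \<open>N\<^sub>c - 1\<close>, applied to \<partial>^s of the Gaussian.\<close>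

definition deriv_weight :: "nat \<Rightarrow> nat ^ 'd::finite \<Rightarrow> real ^ 'd \<Rightarrow> real" where
  "deriv_weight N\<^sub>c s y = (\<Sum>j = 0..N\<^sub>c - 1. (- 1) ^ j / (2 ^ j * fact j) * laplacian_hermite s j y)"

text \<open>
  Binomial coefficients with $l>k$ vanish, so the sum is effectively over $l\le\min(k,N_c-1)$ and
  covers the orders $k<N_c$ as well.
\<close>

definition error_coeff :: "nat \<Rightarrow> nat \<Rightarrow> real" where
  "error_coeff N\<^sub>c k = (\<Sum>l = 0..N\<^sub>c - 1. (- 1) ^ l * real (k choose l)) / (2 ^ k * fact k)"

lemma error_coeff_0: "error_coeff N\<^sub>c 0 = 1"
proof -
  have "(\<Sum>l = 0..N\<^sub>c - 1. (- 1) ^ l * real (0 choose l)) = (\<Sum>l = 0..N\<^sub>c - 1. if l = 0 then 1 else 0)"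
    by (rule sum.cong) (auto simp: gr0_conv_Suc)
  then show ?thesis by (simp add: error_coeff_def)
qed

lemma error_coeff_eq_0:
  assumes "0 < k" "k < N\<^sub>c"
  shows "error_coeff N\<^sub>c k = 0"
proof -
  \<comment> \<open>As \<open>k < N\<^sub>c\<close>, the range contains the whole binomial row, and
    everything beyond the row is zero.\<close>
  have "(\<Sum>l = 0..N\<^sub>c - 1. (- 1) ^ l * real (k choose l)) = (\<Sum>l\<le>k. (- 1) ^ l * real (k choose l))"
    using assms by (intro sum.mono_neutral_right) auto
  then show ?thesis using choose_alternating_sum[OF assms(1), where ?'a = real]
    by (simp add: error_coeff_def)
qed

lemma error_coeff_eq:
  assumes "N\<^sub>c \<le> k" "N\<^sub>c \<ge> 1"
  shows "error_coeff N\<^sub>c k = (\<Sum>l = 0..N\<^sub>c - 1. (- 1) ^ l / (2 ^ l * fact l) * (1 / (2 ^ (k - l) * fact (k - l))))"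
  unfolding error_coeff_def sum_divide_distrib
proof (rule sum.cong[OF refl])
  fix l assume "l \<in> {0..N\<^sub>c - 1}"
  \<comment> \<open>This makes \<open>k - l\<close> a genuine difference, so the factorial form of
    the binomial coefficient applies.\<close>
  then have "l \<le> k" using assms by auto
  then have "real (k choose l) = fact k / (fact l * fact (k - l))"
    by (rule binomial_fact)
  moreover have "(2 :: real) ^ k = 2 ^ l * 2 ^ (k - l)"
    using \<open>l \<le> k\<close> by (simp flip: power_add)
  ultimately show "(- 1) ^ l * real (k choose l) / (2 ^ k * fact k)
      = (- 1) ^ l / (2 ^ l * fact l) * (1 / (2 ^ (k - l) * fact (k - l)))"
    by simp
qed

text \<open>The third hypothesis is the degree count: the highest Hermite product contributes |s| +
  2(\<open>N\<^sub>c\<close> - 1) and the monomial |\<alpha>|, so exactness holds term by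
  term.\<close>

lemma sum_deriv_weight_power:
  fixes \<Omega> :: "(int ^ 'd::finite) set"
  assumes "invariant_weights \<Omega> w" "hermite_norm_preserving N a \<Omega> w"
    and "msize s + 2 * (N\<^sub>c - 1) + msize \<alpha> \<le> 2 * N + 1"
  shows "(\<Sum>i\<in>\<Omega>. w i * deriv_weight N\<^sub>c s (a *\<^sub>R rvec i) * (\<Prod>k\<in>UNIV. ((a *\<^sub>R rvec i) $ k) ^ (\<alpha> $ k)))
     = (\<Sum>j = 0..N\<^sub>c - 1. (- 1) ^ j / (2 ^ j * fact j) * (\<Sum>\<beta> | msize \<beta> = j. fact j / mfact \<beta> *
          (\<Prod>k\<in>UNIV. gauss_expect (hermite_poly (s $ k + 2 * \<beta> $ k) * monom 1 (\<alpha> $ k)))))"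
proof -
  let ?q = "\<lambda>\<beta> k. hermite_poly (s $ k + 2 * \<beta> $ k) * monom 1 (\<alpha> $ k)"
  have quad: "(\<Sum>i\<in>\<Omega>. w i * (\<Prod>k\<in>UNIV. poly (?q \<beta> k) ((a *\<^sub>R rvec i) $ k)))
      = (\<Prod>k\<in>UNIV. gauss_expect (?q \<beta> k))" if "j \<in> {0..N\<^sub>c - 1}" "\<beta> \<in> {\<beta>. msize \<beta> = j}" for j \<beta>
  proof (rule quadrature_poly[OF assms(1,2)])
    have "degree (?q \<beta> k) \<le> s $ k + 2 * \<beta> $ k + \<alpha> $ k" for k
      by (rule order_trans[OF degree_mult_le]) (simp add: degree_hermite_poly degree_monom_eq)
    then have "(\<Sum>k\<in>UNIV. degree (?q \<beta> k)) \<le> (\<Sum>k\<in>UNIV. s $ k + 2 * \<beta> $ k + \<alpha> $ k)"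
      by (rule sum_mono)
    also have "\<dots> = msize s + 2 * msize \<beta> + msize \<alpha>"
      by (simp add: msize_def sum.distrib sum_distrib_left)
    also have "\<dots> \<le> 2 * N + 1" using that assms(3) by auto
    finally show "(\<Sum>k\<in>UNIV. degree (?q \<beta> k)) \<le> 2 * N + 1" .
  qed
  have "(\<Sum>i\<in>\<Omega>. w i * deriv_weight N\<^sub>c s (a *\<^sub>R rvec i) * (\<Prod>k\<in>UNIV. ((a *\<^sub>R rvec i) $ k) ^ (\<alpha> $ k)))
      = (\<Sum>i\<in>\<Omega>. \<Sum>j = 0..N\<^sub>c - 1. \<Sum>\<beta> | msize \<beta> = j. (- 1) ^ j / (2 ^ j * fact j) * (fact j / mfact \<beta> *
          (w i * (\<Prod>k\<in>UNIV. poly (?q \<beta> k) ((a *\<^sub>R rvec i) $ k)))))"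
    unfolding deriv_weight_def laplacian_hermite_eq poly_mult poly_monom prod.distrib mult_1
      sum_distrib_left sum_distrib_right
    by (intro sum.cong refl) (simp add: mult_ac)
  also have "\<dots> = (\<Sum>j = 0..N\<^sub>c - 1. \<Sum>\<beta> | msize \<beta> = j. \<Sum>i\<in>\<Omega>. (- 1) ^ j / (2 ^ j * fact j) * (fact j / mfact \<beta> *
          (w i * (\<Prod>k\<in>UNIV. poly (?q \<beta> k) ((a *\<^sub>R rvec i) $ k)))))"
    by (subst sum.swap) (intro sum.cong refl sum.swap)
  also have "\<dots> = (\<Sum>j = 0..N\<^sub>c - 1. \<Sum>\<beta> | msize \<beta> = j. (- 1) ^ j / (2 ^ j * fact j) * (fact j / mfact \<beta> *
          (\<Prod>k\<in>UNIV. gauss_expect (?q \<beta> k))))"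
    by (intro sum.cong refl) (simp only: sum_distrib_left[symmetric] quad)
  finally show ?thesis by (simp only: sum_distrib_left)
qed

text \<open>For $b>r$ both sides vanish, which spares the restriction to multi-indices $\beta\le\kappa$ later.\<close>

lemma gauss_expect_hermite_poly_monom_double:
  "gauss_expect (hermite_poly (p + 2 * b) * monom 1 (p + r + r))
     = fact (p + r + r) * fact b / fact r * real (r choose b) * 2 ^ b / 2 ^ r"
proof (cases "b \<le> r")
  case True
  have 1: "p + r + r - (p + 2 * b) = 2 * (r - b)" using True by simp
  have 2: "real (r choose b) = fact r / (fact b * fact (r - b))" using True by (rule binomial_fact)
  have 3: "(2 :: real) ^ r = 2 ^ b * 2 ^ (r - b)" using True by (simp flip: power_add)
  show ?thesis
    unfolding gauss_expect_hermite_poly_monom 1 2 3 gauss_moment_double using True by simp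
qed (simp add: gauss_expect_hermite_poly_monom)

text \<open>The factor \<beta>! from the one-dimensional integrals cancels the multinomial
  denominator, and Vandermonde collapses the remaining binomials to |\<kappa>| choose j. The weights
  1/(2^j j!) then cancel too, leaving a truncated alternating binomial row.\<close>

lemma sum_deriv_weight_power_double:
  fixes \<Omega> :: "(int ^ 'd::finite) set"
  assumes "invariant_weights \<Omega> w" "hermite_norm_preserving N a \<Omega> w"
    and "msize s + 2 * (N\<^sub>c - 1) + msize (s + \<kappa> + \<kappa>) \<le> 2 * N + 1"
  shows "(\<Sum>i\<in>\<Omega>. w i * deriv_weight N\<^sub>c s (a *\<^sub>R rvec i) * (\<Prod>k\<in>UNIV. ((a *\<^sub>R rvec i) $ k) ^ ((s + \<kappa> + \<kappa>) $ k)))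
     = mfact (s + \<kappa> + \<kappa>) * (fact (msize \<kappa>) / mfact \<kappa>) * error_coeff N\<^sub>c (msize \<kappa>)"
proof -
  let ?\<alpha> = "s + \<kappa> + \<kappa>" and ?m = "msize \<kappa>"
  have prod: "(\<Prod>k\<in>UNIV. gauss_expect (hermite_poly (s $ k + 2 * \<beta> $ k) * monom 1 (?\<alpha> $ k)))
      = mfact ?\<alpha> * mfact \<beta> / mfact \<kappa> * (\<Prod>k\<in>UNIV. real (\<kappa> $ k choose \<beta> $ k)) * 2 ^ msize \<beta> / 2 ^ ?m" for \<beta>
    by (simp add: gauss_expect_hermite_poly_monom_double prod.distrib prod_dividef mfact_def msize_def power_sum)
  have "(\<Sum>\<beta> | msize \<beta> = j. fact j / mfact \<beta> *
          (\<Prod>k\<in>UNIV. gauss_expect (hermite_poly (s $ k + 2 * \<beta> $ k) * monom 1 (?\<alpha> $ k))))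
      = (fact j * 2 ^ j) * (mfact ?\<alpha> / (mfact \<kappa> * 2 ^ ?m)) * real (?m choose j)" for j
    unfolding sum_prod_binomial[symmetric] sum_distrib_left prod
    by (rule sum.cong) (auto simp: mfact_nonzero)
  then have "(\<Sum>i\<in>\<Omega>. w i * deriv_weight N\<^sub>c s (a *\<^sub>R rvec i) * (\<Prod>k\<in>UNIV. ((a *\<^sub>R rvec i) $ k) ^ (?\<alpha> $ k)))
      = (\<Sum>j = 0..N\<^sub>c - 1. (- 1) ^ j / (2 ^ j * fact j) * ((fact j * 2 ^ j) * (mfact ?\<alpha> / (mfact \<kappa> * 2 ^ ?m)) * real (?m choose j)))"
    unfolding sum_deriv_weight_power[OF assms] by simp
  also have "\<dots> = (\<Sum>j = 0..N\<^sub>c - 1. mfact ?\<alpha> / (mfact \<kappa> * 2 ^ ?m) * ((- 1) ^ j * real (?m choose j)))"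
    by (rule sum.cong) auto
  also have "\<dots> = mfact ?\<alpha> * (fact ?m / mfact \<kappa>) * error_coeff N\<^sub>c ?m"
    unfolding error_coeff_def sum_distrib_left[symmetric] by simp
  finally show ?thesis .
qed

text \<open>Some coordinate has \<alpha>_k below s_k or an odd excess over it. Adding 2\<beta>_k to
  s_k changes neither defect into a nonzero case: the Hermite degree is too high or the remaining
  moment is odd.\<close>

lemma sum_deriv_weight_power_eq_0:
  fixes \<Omega> :: "(int ^ 'd::finite) set"
  assumes "invariant_weights \<Omega> w" "hermite_norm_preserving N a \<Omega> w"
    and "msize s + 2 * (N\<^sub>c - 1) + msize \<alpha> \<le> 2 * N + 1"
    and "\<alpha> \<notin> range (\<lambda>\<kappa>. s + \<kappa> + \<kappa>)"
  shows "(\<Sum>i\<in>\<Omega>. w i * deriv_weight N\<^sub>c s (a *\<^sub>R rvec i) * (\<Prod>k\<in>UNIV. ((a *\<^sub>R rvec i) $ k) ^ (\<alpha> $ k))) = 0"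
proof -
  have "\<exists>k. \<alpha> $ k < s $ k \<or> odd (\<alpha> $ k - s $ k)"
  proof (rule ccontr)
    assume *: "\<not> ?thesis"
    have "\<alpha> = s + (\<chi> k. (\<alpha> $ k - s $ k) div 2) + (\<chi> k. (\<alpha> $ k - s $ k) div 2)"
      unfolding vec_eq_iff
    proof
      fix k
      from * have "s $ k \<le> \<alpha> $ k" "even (\<alpha> $ k - s $ k)" by (auto simp: not_less)
      then show "\<alpha> $ k = (s + (\<chi> k. (\<alpha> $ k - s $ k) div 2) + (\<chi> k. (\<alpha> $ k - s $ k) div 2)) $ k"
        by (auto simp: mult_2[symmetric] add.assoc)
    qed
    with assms(4) show False by blast
  qed
  then obtain k where k: "\<alpha> $ k < s $ k \<or> odd (\<alpha> $ k - s $ k)" by blast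
  have "gauss_expect (hermite_poly (s $ k + 2 * \<beta> $ k) * monom 1 (\<alpha> $ k)) = 0" for \<beta> :: "nat ^ 'd"
  proof (cases "s $ k + 2 * \<beta> $ k \<le> \<alpha> $ k")
    case True
    with k have "odd (\<alpha> $ k - (s $ k + 2 * \<beta> $ k))" by auto
    then show ?thesis by (simp add: gauss_expect_hermite_poly_monom gauss_moment_odd)
  qed (simp add: gauss_expect_hermite_poly_monom)
  then have "(\<Prod>k\<in>UNIV. gauss_expect (hermite_poly (s $ k + 2 * \<beta> $ k) * monom 1 (\<alpha> $ k))) = 0"
    for \<beta> :: "nat ^ 'd" by auto
  then show ?thesis
    unfolding sum_deriv_weight_power[OF assms(1-3)] by (simp only: mult_zero_right sum.neutral_const)
qed

text \<open>An exact identity on Taylor polynomials. Doubling the assumption on \<open>K\<close> and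
  adding 1 is precisely the degree count for the top degree |s| + 2K + 1.\<close>

lemma discrete_deriv_taylor_polynomial:
  fixes \<Omega> :: "(int ^ 'd::finite) set"
  assumes "invariant_weights \<Omega> w" "hermite_norm_preserving N a \<Omega> w" "smooth f"
    and "msize s + (N\<^sub>c - 1) + K \<le> N" and "a > 0" "h > 0"
  shows "(a / h) ^ msize s * (\<Sum>i\<in>\<Omega>. w i * deriv_weight N\<^sub>c s (a *\<^sub>R rvec i) *
           (\<Sum>\<alpha> | msize \<alpha> \<le> msize s + 2 * K + 1.
              mixed_partial \<alpha> f x / mfact \<alpha> * (\<Prod>k\<in>UNIV. (rvec i $ k) ^ (\<alpha> $ k)) * h ^ msize \<alpha>))
       = (\<Sum>k = 0..K. error_coeff N\<^sub>c k * (h / a) ^ (2 * k) * (laplacian ^^ k) (mixed_partial s f) x)"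
proof -
  let ?n = "msize s" and ?A = "{\<alpha> :: nat ^ 'd. msize \<alpha> \<le> msize s + 2 * K + 1}"
  let ?J = "\<lambda>\<alpha>. \<Sum>i\<in>\<Omega>. w i * deriv_weight N\<^sub>c s (a *\<^sub>R rvec i) * (\<Prod>k\<in>UNIV. ((a *\<^sub>R rvec i) $ k) ^ (\<alpha> $ k))"
  let ?C = "\<lambda>\<alpha>. mixed_partial \<alpha> f x / mfact \<alpha>"
  let ?T = "\<lambda>\<alpha>. (a / h) ^ ?n * ((h / a) ^ msize \<alpha> * ?C \<alpha> * ?J \<alpha>)"
  have le: "?n + 2 * (N\<^sub>c - 1) + msize \<alpha> \<le> 2 * N + 1" if "\<alpha> \<in> ?A" for \<alpha>
    using that assms(4) by auto
  \<comment> \<open>Rescales the displacement h i to the node a i, where the rule is exact; this is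
    the origin of the powers of h/a.\<close>
  have pow: "(\<Prod>k\<in>UNIV. (rvec i $ k) ^ (\<alpha> $ k)) * h ^ msize \<alpha>
      = (h / a) ^ msize \<alpha> * (\<Prod>k\<in>UNIV. ((a *\<^sub>R rvec i) $ k) ^ (\<alpha> $ k))" for i and \<alpha> :: "nat ^ 'd"
    using assms(5) by (simp add: power_mult_distrib prod.distrib msize_def power_sum[symmetric] power_divide)
  have "(a / h) ^ ?n * (\<Sum>i\<in>\<Omega>. w i * deriv_weight N\<^sub>c s (a *\<^sub>R rvec i) *
           (\<Sum>\<alpha>\<in>?A. ?C \<alpha> * (\<Prod>k\<in>UNIV. (rvec i $ k) ^ (\<alpha> $ k)) * h ^ msize \<alpha>))
      = (\<Sum>i\<in>\<Omega>. \<Sum>\<alpha>\<in>?A. (a / h) ^ ?n * ((h / a) ^ msize \<alpha> * ?C \<alpha> *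
           (w i * deriv_weight N\<^sub>c s (a *\<^sub>R rvec i) * (\<Prod>k\<in>UNIV. ((a *\<^sub>R rvec i) $ k) ^ (\<alpha> $ k)))))"
    unfolding sum_distrib_left mult.assoc pow by (intro sum.cong refl) (simp only: mult_ac)
  also have "\<dots> = (\<Sum>\<alpha>\<in>?A. ?T \<alpha>)"
    by (subst sum.swap) (simp only: sum_distrib_left)
  also have "\<dots> = (\<Sum>\<alpha>\<in>(\<lambda>\<kappa>. s + \<kappa> + \<kappa>) ` {\<kappa>. msize \<kappa> \<le> K}. ?T \<alpha>)"
  proof (rule sum.mono_neutral_right[OF finite_msize_le], safe)
    fix \<kappa> :: "nat ^ 'd" assume "msize \<kappa> \<le> K"
    then show "msize (s + \<kappa> + \<kappa>) \<le> ?n + 2 * K + 1" by (simp add: msize_add)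
  next
    fix \<alpha> :: "nat ^ 'd"
    assume \<alpha>: "msize \<alpha> \<le> ?n + 2 * K + 1" "\<alpha> \<notin> (\<lambda>\<kappa>. s + \<kappa> + \<kappa>) ` {\<kappa>. msize \<kappa> \<le> K}"
    then have "\<alpha> \<notin> range (\<lambda>\<kappa>. s + \<kappa> + \<kappa>)" by (auto simp: msize_add)
    with \<alpha>(1) have "?J \<alpha> = 0"
      by (intro sum_deriv_weight_power_eq_0[OF assms(1,2) le]) auto
    then show "?T \<alpha> = 0" by simp
  qed
  also have "\<dots> = (\<Sum>\<kappa> | msize \<kappa> \<le> K. ?T (s + \<kappa> + \<kappa>))"
    by (rule sum.reindex[unfolded o_def]) (auto simp: inj_on_def vec_eq_iff mult_2[symmetric])
  also have "\<dots> = (\<Sum>\<kappa> | msize \<kappa> \<le> K. error_coeff N\<^sub>c (msize \<kappa>) * (h / a) ^ (2 * msize \<kappa>)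
                     * (fact (msize \<kappa>) / mfact \<kappa> * mixed_partial (s + \<kappa> + \<kappa>) f x))"
  proof (rule sum.cong[OF refl])
    fix \<kappa> :: "nat ^ 'd" assume "\<kappa> \<in> {\<kappa>. msize \<kappa> \<le> K}"
    then have "s + \<kappa> + \<kappa> \<in> ?A" by (simp add: msize_add)
    note J = sum_deriv_weight_power_double[OF assms(1,2) le[OF this]]
    \<comment> \<open>The prefactor uses up |s| of the |s| + 2|\<kappa>| powers, so only even ones
      remain.\<close>
    have scale: "(a / h) ^ ?n * (h / a) ^ msize (s + \<kappa> + \<kappa>) = (h / a) ^ (2 * msize \<kappa>)"
    proof -
      have "(a / h) ^ ?n * (h / a) ^ ?n = 1"
        using assms(5,6) by (simp flip: power_mult_distrib)
      then show ?thesis by (simp add: msize_add power_add mult_2 mult.assoc[symmetric])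
    qed
    have "?T (s + \<kappa> + \<kappa>) = ((a / h) ^ ?n * (h / a) ^ msize (s + \<kappa> + \<kappa>)) * (?C (s + \<kappa> + \<kappa>) * ?J (s + \<kappa> + \<kappa>))"
      by (simp only: mult_ac)
    also have "\<dots> = error_coeff N\<^sub>c (msize \<kappa>) * (h / a) ^ (2 * msize \<kappa>)
                     * (fact (msize \<kappa>) / mfact \<kappa> * mixed_partial (s + \<kappa> + \<kappa>) f x)"
      unfolding J scale using mfact_nonzero[of "s + \<kappa> + \<kappa>"] by simp
    finally show "?T (s + \<kappa> + \<kappa>) = error_coeff N\<^sub>c (msize \<kappa>) * (h / a) ^ (2 * msize \<kappa>)
                     * (fact (msize \<kappa>) / mfact \<kappa> * mixed_partial (s + \<kappa> + \<kappa>) f x)" .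
  qed
  \<comment> \<open>Collecting the \<kappa> of equal size reassembles the multinomial expansion of
    \<Delta>^k.\<close>
  also have "\<dots> = (\<Sum>k = 0..K. \<Sum>\<kappa> | \<kappa> \<in> {\<kappa>. msize \<kappa> \<le> K} \<and> msize \<kappa> = k.
                     error_coeff N\<^sub>c (msize \<kappa>) * (h / a) ^ (2 * msize \<kappa>)
                     * (fact (msize \<kappa>) / mfact \<kappa> * mixed_partial (s + \<kappa> + \<kappa>) f x))"
    by (rule sum.group[symmetric]) (auto simp: finite_msize_le)
  also have "\<dots> = (\<Sum>k = 0..K. \<Sum>\<kappa> | msize \<kappa> = k. error_coeff N\<^sub>c k * (h / a) ^ (2 * k)
                     * (fact k / mfact \<kappa> * mixed_partial (s + \<kappa> + \<kappa>) f x))"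
    by (intro sum.cong) auto
  also have "\<dots> = (\<Sum>k = 0..K. error_coeff N\<^sub>c k * (h / a) ^ (2 * k) * (laplacian ^^ k) (mixed_partial s f) x)"
    by (simp only: laplacian_power_mixed_partial[OF assms(3)] sum_distrib_left)
  finally show ?thesis .
qed

theorem mainTheorem2:
  fixes n N\<^sub>c N\<^sub>q :: nat and a :: real
    and \<Omega> :: "(int ^ 'd::finite) set" and w :: "int ^ 'd \<Rightarrow> real"
    and f :: "real ^ 'd \<Rightarrow> real" and x :: "real ^ 'd" and s :: "nat ^ 'd"
  assumes "N\<^sub>c \<ge> 1" and "N\<^sub>q \<ge> n + 2 * (N\<^sub>c - 1)" and "a > 0"
    and "finite \<Omega>" and "invariant_weights \<Omega> w" and "hermite_norm_preserving N\<^sub>q a \<Omega> w"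
    and "smooth f" and "taylor_converges f"
    and "msize s = n"
  shows "(\<lambda>h. discrete_deriv a \<Omega> w N\<^sub>c s f x h - mixed_partial s f x)
           \<in> O[at_right 0](\<lambda>h. h ^ (2 * N\<^sub>c)) \<and>
         (\<lambda>h. discrete_deriv a \<Omega> w N\<^sub>c s f x h
              - (mixed_partial s f x
                 + (\<Sum>k = N\<^sub>c..N\<^sub>q + 1 - n - N\<^sub>c.
                      (\<Sum>l = 0..N\<^sub>c - 1. (- 1) ^ l / (2 ^ l * fact l)
                                      * (1 / (2 ^ (k - l) * fact (k - l))))
                      * (h / a) ^ (2 * k) * (laplacian ^^ k) (mixed_partial s f) x)))
           \<in> O[at_right 0](\<lambda>h. h ^ (2 * (N\<^sub>q + 2 - n - N\<^sub>c)))"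
proof -
  \<comment> \<open>The largest order with n + 2(\<open>N\<^sub>c\<close> - 1) + (n + 2K + 1) \<le>
    2 \<open>N\<^sub>q\<close> + 1. The bound on \<open>N\<^sub>q\<close> makes the natural
    subtraction genuine and gives K \<ge> \<open>N\<^sub>c - 1\<close>; in the case of equality the
    error sum is empty.\<close>
  define K where "K = N\<^sub>q + 1 - n - N\<^sub>c"
  have K: "msize s + (N\<^sub>c - 1) + K \<le> N\<^sub>q" "N\<^sub>q + 2 - n - N\<^sub>c = Suc K" "N\<^sub>c \<le> Suc K"
    using assms(1,2,9) by (auto simp: K_def)
  let ?W = "\<lambda>i. w i * deriv_weight N\<^sub>c s (a *\<^sub>R rvec i)"
  let ?P = "\<lambda>i h. \<Sum>\<alpha> | msize \<alpha> \<le> msize s + 2 * K + 1.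
      mixed_partial \<alpha> f x / mfact \<alpha> * (\<Prod>k\<in>UNIV. (rvec i $ k) ^ (\<alpha> $ k)) * h ^ msize \<alpha>"
  let ?L = "\<lambda>k. (laplacian ^^ k) (mixed_partial s f) x"
  let ?E = "\<lambda>h. \<Sum>k = N\<^sub>c..K. (\<Sum>l = 0..N\<^sub>c - 1. (- 1) ^ l / (2 ^ l * fact l)
                  * (1 / (2 ^ (k - l) * fact (k - l)))) * (h / a) ^ (2 * k) * ?L k"
  let ?R = "\<lambda>h. \<Sum>i\<in>\<Omega>. ?W i * (f (x + h *\<^sub>R rvec i) - ?P i h)"
  have main: "(\<Sum>k = 0..K. error_coeff N\<^sub>c k * (h / a) ^ (2 * k) * ?L k) = mixed_partial s f x + ?E h" for h
  proof -
    have "(\<Sum>k = 0..K. error_coeff N\<^sub>c k * (h / a) ^ (2 * k) * ?L k)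
        = (\<Sum>k\<in>insert 0 {N\<^sub>c..K}. error_coeff N\<^sub>c k * (h / a) ^ (2 * k) * ?L k)"
      by (rule sum.mono_neutral_right) (auto simp: error_coeff_eq_0)
    also have "\<dots> = mixed_partial s f x + (\<Sum>k = N\<^sub>c..K. error_coeff N\<^sub>c k * (h / a) ^ (2 * k) * ?L k)"
      using assms(1) by (simp add: error_coeff_0)
    also have "(\<Sum>k = N\<^sub>c..K. error_coeff N\<^sub>c k * (h / a) ^ (2 * k) * ?L k) = ?E h"
      using assms(1) by (intro sum.cong refl) (simp only: error_coeff_eq atLeastAtMost_iff)
    finally show ?thesis .
  qed
  have remainder: "discrete_deriv a \<Omega> w N\<^sub>c s f x h - (mixed_partial s f x + ?E h) = (a / h) ^ msize s * ?R h"
    if "h > 0" for h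
  proof -
    have "discrete_deriv a \<Omega> w N\<^sub>c s f x h = (a / h) ^ msize s * (\<Sum>i\<in>\<Omega>. ?W i * f (x + h *\<^sub>R rvec i))"
      by (simp only: discrete_deriv_def deriv_weight_def)
    then show ?thesis
      unfolding main[symmetric]
        discrete_deriv_taylor_polynomial[OF assms(5,6,7) K(1) assms(3) that, symmetric]
      by (simp only: right_diff_distrib sum_subtractf)
  qed
  \<comment> \<open>The Taylor polynomial reaches the odd offset 2K + 1, so the first omitted degree
    is |s| + 2(K + 1).\<close>
  have R: "?R \<in> O[at_right 0](\<lambda>h. h ^ (msize s + 2 * Suc K))"
  proof (rule big_sum_in_bigo)
    fix i assume "i \<in> \<Omega>"
    have "(\<lambda>h. f (x + h *\<^sub>R rvec i) - ?P i h) \<in> O[at_right 0](\<lambda>h. h ^ (msize s + 2 * Suc K))"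
      using taylor_remainder_bigo[OF assms(8), of x "rvec i" "msize s + 2 * K + 1"] by simp
    then show "(\<lambda>h. ?W i * (f (x + h *\<^sub>R rvec i) - ?P i h)) \<in> O[at_right 0](\<lambda>h. h ^ (msize s + 2 * Suc K))"
      by (cases "?W i = 0") auto
  qed
  have pos: "eventually (\<lambda>h :: real. h > 0) (at_right 0)"
    by (rule eventually_at_right_less)
  have "(\<lambda>h. (a / h) ^ msize s * ?R h) \<in> O[at_right 0](\<lambda>h. (a / h) ^ msize s * h ^ (msize s + 2 * Suc K))"
    by (rule landau_o.big.mult[OF landau_o.big_refl R])
  also have "(\<lambda>h. (a / h) ^ msize s * h ^ (msize s + 2 * Suc K)) \<in> O[at_right 0](\<lambda>h. h ^ (2 * Suc K))"
  proof (rule bigoI[of _ "a ^ msize s"])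
    show "\<forall>\<^sub>F h in at_right 0. norm ((a / h) ^ msize s * h ^ (msize s + 2 * Suc K))
            \<le> a ^ msize s * norm (h ^ (2 * Suc K))"
      using pos
    proof eventually_elim
      case (elim h)
      then show ?case using assms(3)
        by (simp only: power_add power_divide norm_mult norm_divide norm_power) simp
    qed
  qed
  finally have "(\<lambda>h. (a / h) ^ msize s * ?R h) \<in> O[at_right 0](\<lambda>h. h ^ (2 * Suc K))" .
  then have second: "(\<lambda>h. discrete_deriv a \<Omega> w N\<^sub>c s f x h - (mixed_partial s f x + ?E h))
      \<in> O[at_right 0](\<lambda>h. h ^ (2 * Suc K))"
    by (rule landau_o.big.in_cong[THEN iffD2, rotated]) (rule eventually_mono[OF pos remainder])
  have power_bigo: "(\<lambda>h :: real. h ^ p) \<in> O[at_right 0](\<lambda>h. h ^ q)" if "q \<le> p" for p q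
  proof (rule bigoI[of _ 1])
    have "eventually (\<lambda>h :: real. h \<in> {0<..<1}) (at_right 0)"
      by (rule eventually_at_right_real) simp
    then show "\<forall>\<^sub>F h :: real in at_right 0. norm (h ^ p) \<le> 1 * norm (h ^ q)"
      by eventually_elim (use that in \<open>simp add: power_decreasing\<close>)
  qed
  \<comment> \<open>The first estimate follows from the second: the error sum starts at h^(2
    \<open>N\<^sub>c\<close>), and the remainder is at least as small because
    \<open>N\<^sub>c \<le> Suc K\<close>.\<close>
  have "?E \<in> O[at_right 0](\<lambda>h. h ^ (2 * N\<^sub>c))"
  proof (rule big_sum_in_bigo)
    fix k assume "k \<in> {N\<^sub>c..K}"
    then have "(\<lambda>h :: real. h ^ (2 * k)) \<in> O[at_right 0](\<lambda>h. h ^ (2 * N\<^sub>c))"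
      by (intro power_bigo) simp
    then have "(\<lambda>h. c * h ^ (2 * k)) \<in> O[at_right 0](\<lambda>h. h ^ (2 * N\<^sub>c))" for c :: real
      by (cases "c = 0") auto
    from this[of "(\<Sum>l = 0..N\<^sub>c - 1. (- 1) ^ l / (2 ^ l * fact l) * (1 / (2 ^ (k - l) * fact (k - l)))) * ?L k / a ^ (2 * k)"]
    show "(\<lambda>h. (\<Sum>l = 0..N\<^sub>c - 1. (- 1) ^ l / (2 ^ l * fact l) * (1 / (2 ^ (k - l) * fact (k - l))))
                 * (h / a) ^ (2 * k) * ?L k) \<in> O[at_right 0](\<lambda>h. h ^ (2 * N\<^sub>c))"
      by (simp only: power_divide times_divide_eq_left times_divide_eq_right mult.assoc mult.commute[of "?L k"])
  qed
  moreover have "(\<lambda>h. discrete_deriv a \<Omega> w N\<^sub>c s f x h - (mixed_partial s f x + ?E h))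
      \<in> O[at_right 0](\<lambda>h. h ^ (2 * N\<^sub>c))"
    by (rule landau_o.big_trans[OF second power_bigo]) (use K(3) in simp)
  ultimately have "(\<lambda>h. (discrete_deriv a \<Omega> w N\<^sub>c s f x h - (mixed_partial s f x + ?E h)) + ?E h)
      \<in> O[at_right 0](\<lambda>h. h ^ (2 * N\<^sub>c))"
    by (intro sum_in_bigo(1))
  then have first: "(\<lambda>h. discrete_deriv a \<Omega> w N\<^sub>c s f x h - mixed_partial s f x)
      \<in> O[at_right 0](\<lambda>h. h ^ (2 * N\<^sub>c))"
    by (simp only: diff_diff_eq[symmetric] diff_add_cancel)
  show ?thesis
    using first second unfolding K(2) K_def[symmetric] by (rule conjI)
qed

end
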